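(* Let $\bar\beta=\{\beta_k\}_{k=1}^\infty$, $\beta_k\in\mathbb R$, and let the sequence $\psi(k)>0$, $k\in\mathbb N$, be strictly decreasing and satisfy $$\lim_{k\to\infty}\frac{\psi(k+1)}{\psi(k)}=0.$$ Let $P_N$ denote any one of the widths $b_N,d_N,\lambda_N,\pi_N$. Then as $n\to\infty$ the following asymptotic equalities hold: each of the two quantities $P_{2n}(C_{\bar\beta,2}^\psi,C)$ and $P_{2n-1}(C_{\bar\beta,2}^\psi,C)$ is equal to $$\psi(n)\left(\frac1{\sqrt\pi}+\mathcal O(1)\max\left\{\psi(n)\left(\sum_{k=1}^{n-1}\frac1{\psi^2(k)}\right)^{\frac12},\ \frac1{\psi(n)}\left(\sum_{k=n+1}^\infty\psi^2(k)\right)^{\frac12}\right\}\right),$$ where $\mathcal O(1)$ are quantities uniformly bounded in all parameters.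
   Context: $L_2$ is the space of (real-valued) $2\pi$-periodic functions with norm $\|f\|_2=\left(\int_{-\pi}^{\pi}|f(t)|^2dt\right)^{1/2}$; $C$ is the space of (real-valued) continuous $2\pi$-periodic functions with norm $\|f\|_C=\max_t|f(t)|$. Sums over an empty index set are $0$. The class $C^\psi_{\bar\beta,2}$ is the set of all $2\pi$-periodic functions $f$ representable as $$f(x)=\frac{a_0}{2}+\frac1\pi\int_{-\pi}^{\pi}\varphi(x-t)\Psi_{\bar\beta}(t)\,dt,\quad a_0\in\mathbb R,\ \varphi\in L_2,\ \|\varphi\|_2\le 1,\ \int_{-\pi}^{\pi}\varphi(t)\,dt=0,$$ where $\Psi_{\bar\beta}\in L_2$ is the fixed function with Fourier series $\sum_{k=1}^\infty\psi(k)\cos\left(kt-\frac{\beta_k\pi}{2}\right)$. One has $C^\psi_{\bar\beta,2}\subset C$. Widths: let $K$ be a convex centrally symmetric subset of $C$, $B$ the unit ball of $C$, $F_N$ an arbitrary $N$-dimensional subspace of $C$, $\mathscr L(C,F_N)$ the set of linear operators from $C$ to $F_N$, and $\mathscr P(C,F_N)\subset\mathscr L(C,F_N)$ the subset of projections, i.e. operators $A$ with $Af=f$ for $f\in F_N$. The Bernstein, Kolmogorov, linear and projection $N$-widths of $K$ in $C$ are, respectively, $$b_N(K,C)=\sup_{F_{N+1}}\sup\{\varepsilon>0:\ \varepsilon B\cap F_{N+1}\subset K\},\qquad d_N(K,C)=\inf_{F_N}\sup_{f\in K}\inf_{u\in F_N}\|f-u\|_C,$$ $$\lambda_N(K,C)=\inf_{F_N}\inf_{A\in\mathscr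 L(C,F_N)}\sup_{f\in K}\|f-Af\|_C,\qquad \pi_N(K,C)=\inf_{F_N}\inf_{A\in\mathscr P(C,F_N)}\sup_{f\in K}\|f-Af\|_C.$$ "$\mathcal O(1)$ uniformly bounded in all parameters" means bounded in absolute value by an absolute constant, independent of $n$, $\psi$, $\bar\beta$ and of the choice of width. *)

theory Defs
  imports "HOL-Analysis.Analysis"
begin

definition periodic_2pi :: "(real \<Rightarrow> 'a) \<Rightarrow> bool" where
  "periodic_2pi f \<longleftrightarrow> (\<forall>x. f (x + 2 * pi) = f x)"


subsection \<open>The space \<open>L\<^sub>2\<close> and Fourier series\<close>

text \<open>Elements of \<open>L\<^sub>2\<close> are represented by functions rather than by classes modulo
  equality almost everywhere; none of the notions below depends on the representative.\<close>

definition L2_periodic :: "(real \<Rightarrow> real) set" where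
  "L2_periodic = {f. periodic_2pi f \<and> f \<in> borel_measurable lebesgue \<and>
     set_integrable lebesgue {-pi..pi} (\<lambda>t. (f t)\<^sup>2)}"

definition L2_norm_periodic :: "(real \<Rightarrow> real) \<Rightarrow> real" where
  "L2_norm_periodic f = sqrt (LINT t:{-pi..pi}|lebesgue. (f t)\<^sup>2)"

definition fourier_cos_coeff :: "(real \<Rightarrow> real) \<Rightarrow> nat \<Rightarrow> real" where
  "fourier_cos_coeff f k = 1 / pi * (LINT t:{-pi..pi}|lebesgue. f t * cos (real k * t))"

definition fourier_sin_coeff :: "(real \<Rightarrow> real) \<Rightarrow> nat \<Rightarrow> real" where
  "fourier_sin_coeff f k = 1 / pi * (LINT t:{-pi..pi}|lebesgue. f t * sin (real k * t))"

definition fourier_term :: "(real \<Rightarrow> real) \<Rightarrow> nat \<Rightarrow> real \<Rightarrow> real" where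
  "fourier_term f k t =
     (if k = 0 then fourier_cos_coeff f 0 / 2
      else fourier_cos_coeff f k * cos (real k * t) + fourier_sin_coeff f k * sin (real k * t))"


subsection \<open>The class \<open>C\<^sup>\<psi>\<close> of convolutions\<close>

text \<open>Sequences are indexed by \<open>k \<ge> 1\<close>; the values \<open>\<psi> 0\<close> and \<open>\<beta> 0\<close> are never used.\<close>

definition is_kernel :: "(nat \<Rightarrow> real) \<Rightarrow> (nat \<Rightarrow> real) \<Rightarrow> (real \<Rightarrow> real) \<Rightarrow> bool" where
  "is_kernel \<psi> \<beta> \<Psi> \<longleftrightarrow> \<Psi> \<in> L2_periodic \<and> (\<forall>t. fourier_term \<Psi> 0 t = 0) \<and>
     (\<forall>k\<ge>1. \<forall>t. fourier_term \<Psi> k t = \<psi> k * cos (real k * t - \<beta> k * pi / 2))"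

text \<open>The kernel is determined up to a null set by its Fourier series, so that quantifying
  over it existentially amounts to fixing it. No membership can hold unless it exists.\<close>

definition conv_class :: "(nat \<Rightarrow> real) \<Rightarrow> (nat \<Rightarrow> real) \<Rightarrow> (real \<Rightarrow> real) set" where
  "conv_class \<psi> \<beta> = {f. periodic_2pi f \<and>
     (\<exists>\<Psi> a\<^sub>0 \<phi>. is_kernel \<psi> \<beta> \<Psi> \<and>
        \<phi> \<in> L2_periodic \<and> L2_norm_periodic \<phi> \<le> 1 \<and> (LINT t:{-pi..pi}|lebesgue. \<phi> t) = 0 \<and>
        (\<forall>x. f x = a\<^sub>0 / 2 + 1 / pi * (LINT t:{-pi..pi}|lebesgue. \<phi> (x - t) * \<Psi> t)))}"


subsection \<open>The space \<open>C\<close> and its widths\<close>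

text \<open>A continuous periodic function is bounded, so \<open>C\<close> is a subspace of the type of bounded
  continuous functions, whose norm is the supremum norm.\<close>

definition C_periodic :: "(real \<Rightarrow>\<^sub>C real) set" where
  "C_periodic = {f. periodic_2pi (apply_bcontfun f)}"

text \<open>A convolution of two functions from \<open>L\<^sub>2\<close> is continuous, so no element of
  \<^term>\<open>conv_class \<psi> \<beta>\<close> is lost here.\<close>

definition C_conv_class :: "(nat \<Rightarrow> real) \<Rightarrow> (nat \<Rightarrow> real) \<Rightarrow> (real \<Rightarrow>\<^sub>C real) set" where
  "C_conv_class \<psi> \<beta> = {f \<in> C_periodic. apply_bcontfun f \<in> conv_class \<psi> \<beta>}"

text \<open>The basis is explicit because \<^const>\<open>dim\<close> also returns \<open>0\<close> on infinite-dimensional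
  spaces.\<close>

definition C_subspaces :: "nat \<Rightarrow> (real \<Rightarrow>\<^sub>C real) set set" where
  "C_subspaces N = {F. F \<subseteq> C_periodic \<and>
     (\<exists>B. finite B \<and> independent B \<and> card B = N \<and> span B = F)}"

text \<open>Operators are total functions, constrained only on \<open>C\<close>; they need not be continuous.\<close>

definition C_linear_operators ::
    "(real \<Rightarrow>\<^sub>C real) set \<Rightarrow> ((real \<Rightarrow>\<^sub>C real) \<Rightarrow> (real \<Rightarrow>\<^sub>C real)) set" where
  "C_linear_operators F = {A. (\<forall>f\<in>C_periodic. A f \<in> F) \<and>
     (\<forall>f\<in>C_periodic. \<forall>g\<in>C_periodic. A (f + g) = A f + A g) \<and>
     (\<forall>c. \<forall>f\<in>C_periodic. A (c *\<^sub>R f) = c *\<^sub>R A f)}"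

definition C_projections ::
    "(real \<Rightarrow>\<^sub>C real) set \<Rightarrow> ((real \<Rightarrow>\<^sub>C real) \<Rightarrow> (real \<Rightarrow>\<^sub>C real)) set" where
  "C_projections F = {A \<in> C_linear_operators F. \<forall>f\<in>F. A f = f}"

text \<open>The widths take values in \<open>[0, \<infinity>]\<close>, since the inner suprema may be infinite; the
  supremum of the empty set is \<open>0\<close>.\<close>

definition bernstein_width :: "nat \<Rightarrow> (real \<Rightarrow>\<^sub>C real) set \<Rightarrow> ennreal" where
  "bernstein_width N K =
     (SUP F\<in>C_subspaces (N + 1). SUP \<epsilon>\<in>{\<epsilon>. 0 < \<epsilon> \<and> cball 0 \<epsilon> \<inter> F \<subseteq> K}. ennreal \<epsilon>)"

definition kolmogorov_width :: "nat \<Rightarrow> (real \<Rightarrow>\<^sub>C real) set \<Rightarrow> ennreal" where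
  "kolmogorov_width N K = (INF F\<in>C_subspaces N. SUP f\<in>K. INF u\<in>F. ennreal (norm (f - u)))"

definition linear_width :: "nat \<Rightarrow> (real \<Rightarrow>\<^sub>C real) set \<Rightarrow> ennreal" where
  "linear_width N K =
     (INF F\<in>C_subspaces N. INF A\<in>C_linear_operators F. SUP f\<in>K. ennreal (norm (f - A f)))"

definition projection_width :: "nat \<Rightarrow> (real \<Rightarrow>\<^sub>C real) set \<Rightarrow> ennreal" where
  "projection_width N K =
     (INF F\<in>C_subspaces N. INF A\<in>C_projections F. SUP f\<in>K. ennreal (norm (f - A f)))"

end

theory Submission
  imports Defs "Jordan_Normal_Form.Determinant"
begin

text \<open>The widths are estimated from above by Fourier projections and from below by trigonometric
polynomials in the class; the constant \<open>1\<close> serves for all four. Throughout,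
\<open>trig 0, trig 1, trig 2, \<dots>\<close> are the functions \<open>1, sin x, cos x, sin 2x, cos 2x, \<dots>\<close>, so that
the first \<open>2 * n - 1\<close> of them span the trigonometric polynomials of degree less than \<open>n\<close>.

From above. The kernel of the class is determined almost everywhere by its Fourier series
(\<open>fourier_uniqueness\<close>), and the series converges absolutely because \<open>\<psi>\<close> decreases faster
than any geometric sequence. An element of the class is therefore a constant plus a series of
harmonics of amplitudes \<open>\<psi> k * a k\<close> where, by Bessel's inequality, the squares \<open>(a k)\<^sup>2\<close> sum to at
most \<open>1 / pi\<close>. The Fourier projection onto the first \<open>N\<close> functions, \<open>N \<ge> 2 * n - 1\<close>, leaves only
harmonics of degree at least \<open>n\<close>, and the Cauchy-Schwarz inequality bounds the remainder by
\<open>sqrt ((\<psi> n)\<^sup>2 + (\<psi> (n + 1))\<^sup>2 + \<dots>) / sqrt pi\<close> (\<open>norm_fourier_remainder_le\<close>). That bounds the projection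
width, hence the linear and the Kolmogorov width. It bounds the Bernstein width as well: a
subspace of dimension \<open>N + 1\<close> contains a nonzero function that the projection annihilates.

From below. On \<open>2 * n\<close> equidistant nodes the trigonometric functions of degree less than \<open>n\<close>
stay orthogonal, and alternating averages recover the harmonic of degree \<open>n\<close> alone. So the
amplitude of the top harmonic of a polynomial of degree \<open>n\<close> is at most the maximum \<open>\<epsilon>\<close> of its
modulus, without loss of a constant, while the amplitudes of the lower ones are at most
\<open>sqrt 2 * \<epsilon>\<close>. If \<open>\<epsilon>\<close> is \<open>width_lower \<psi> n\<close>, such a polynomial lies in the class. This settles
the Bernstein width. For the Kolmogorov width let \<open>F\<close> have dimension at most \<open>2 * n\<close>. Moving the
nodes by one step permutes them by a cycle of even length, an odd permutation, so the determinant
of the values of a basis of \<open>F\<close> changes its sign and vanishes for some position of the nodes. There a nonzero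
functional \<open>\<Sum>j. c j * u (x j)\<close> vanishes on \<open>F\<close>. The polynomial that takes the values
\<open>\<epsilon> * sgn (c j)\<close> at the nodes is again in the class, and its distance to \<open>F\<close> is at least \<open>\<epsilon>\<close>.
This replaces the theorem of Borsuk in the usual comparison of the two widths.\<close>

section \<open>Integration over the circle\<close>

abbreviation circle :: "real measure" where
  "circle \<equiv> lebesgue_on {-pi..pi}"

lemma set_integrable_circle: "set_integrable lebesgue {-pi..pi} f \<longleftrightarrow> integrable circle f"
  for f :: "real \<Rightarrow> real"
  by (simp add: set_integrable_def integrable_restrict_space)

lemma set_integral_circle: "(LINT t:{-pi..pi}|lebesgue. f t) = integral\<^sup>L circle f"
  for f :: "real \<Rightarrow> real"
  by (simp add: set_lebesgue_integral_def integral_restrict_space)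

lemma finite_measure_circle: "finite_measure circle"
  by (simp add: finite_measure_lebesgue_on)

lemma measure_circle: "measure circle (space circle) = 2 * pi"
  by (simp add: measure_restrict_space)

lemma integrable_circle_continuous:
  fixes f :: "real \<Rightarrow> real"
  assumes "continuous_on UNIV f"
  shows "integrable circle f"
  using assms continuous_imp_integrable_real continuous_on_subset by blast

lemma integrable_circle_mult_continuous:
  fixes f g :: "real \<Rightarrow> real"
  assumes f: "integrable circle f" and g: "continuous_on UNIV g"
  shows "integrable circle (\<lambda>t. f t * g t)"
proof -
  have "compact (g ` {-pi..pi})"
    using g by (intro compact_continuous_image) (auto intro: continuous_on_subset)
  then have "bounded (g ` {-pi..pi})"
    by (rule compact_imp_bounded)
  then obtain B where "\<forall>y\<in>g ` {-pi..pi}. norm y \<le> B"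
    unfolding bounded_iff by blast
  then have B: "\<And>t. t \<in> {-pi..pi} \<Longrightarrow> \<bar>g t\<bar> \<le> B"
    by auto
  have gm: "g \<in> borel_measurable circle"
    using integrable_circle_continuous[OF g] by (rule borel_measurable_integrable)
  show ?thesis
  proof (rule Bochner_Integration.integrable_bound)
    show "integrable circle (\<lambda>t. B * f t)"
      using f by simp
    show "(\<lambda>t. f t * g t) \<in> borel_measurable circle"
      using f gm by measurable
    show "AE t in circle. norm (f t * g t) \<le> norm (B * f t)"
    proof (rule AE_I2)
      fix t assume "t \<in> space circle"
      then have "\<bar>g t\<bar> \<le> B" using B by simp
      then have "\<bar>g t\<bar> * \<bar>f t\<bar> \<le> \<bar>B\<bar> * \<bar>f t\<bar>"
        by (intro mult_right_mono) auto
      then show "norm (f t * g t) \<le> norm (B * f t)"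
        by (simp add: abs_mult mult.commute)
    qed
  qed
qed

text \<open>On a set of finite measure \<open>\<bar>f\<bar> \<le> 1 + f\<^sup>2\<close> gives the inclusion of \<open>L\<^sub>2\<close> in \<open>L\<^sub>1\<close>.\<close>

lemma integrable_circle_of_square:
  fixes f :: "real \<Rightarrow> real"
  assumes m: "f \<in> borel_measurable circle" and i: "integrable circle (\<lambda>t. (f t)\<^sup>2)"
  shows "integrable circle f"
proof (rule Bochner_Integration.integrable_bound)
  show "integrable circle (\<lambda>t. 1 + (f t)\<^sup>2)"
    using i integrable_circle_continuous[of "\<lambda>_. 1"] by simp
  show "AE t in circle. norm (f t) \<le> norm (1 + (f t)\<^sup>2)"
  proof (rule AE_I2)
    fix t
    have "0 \<le> (\<bar>f t\<bar> - 1)\<^sup>2" by simp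
    then show "norm (f t) \<le> norm (1 + (f t)\<^sup>2)"
      unfolding power2_diff by simp
  qed
qed (fact m)

lemma periodic_2pi_shift_int:
  assumes "periodic_2pi g"
  shows "g (x + 2 * pi * of_int k) = g x"
proof -
  have step: "g (y + 2 * pi) = g y" for y
    using assms by (simp add: periodic_2pi_def)
  have nat: "g (y + 2 * pi * real n) = g y" for y n
  proof (induction n)
    case (Suc n)
    have "g (y + 2 * pi * real (Suc n)) = g ((y + 2 * pi * real n) + 2 * pi)"
      by (simp add: algebra_simps)
    then show ?case using step Suc by simp
  qed simp
  show ?thesis
  proof (cases "k \<ge> 0")
    case True
    then show ?thesis using nat[of x "nat k"] by simp
  next
    case False
    then show ?thesis using nat[of "x + 2 * pi * of_int k" "nat (- k)"] by simp
  qed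
qed

text \<open>The interval \<open>{x - pi..x + pi}\<close> is a full period. After \<open>x\<close> is moved into \<open>{0..<2 * pi}\<close>, the
reflected interval splits at \<open>pi\<close> into two pieces, and the second one is carried back by the period.
The endpoints are null sets.\<close>

lemma
  fixes g :: "real \<Rightarrow> real"
  assumes per: "periodic_2pi g" and int: "integrable circle g"
  shows integrable_circle_reflect: "integrable circle (\<lambda>t. g (x - t))"
    and integral_circle_reflect: "(LINT t|circle. g (x - t)) = integral\<^sup>L circle g"
proof -
  define k where "k = \<lfloor>x / (2 * pi)\<rfloor>"
  define y where "y = x - 2 * pi * of_int k"
  have "of_int k \<le> x / (2 * pi)" "x / (2 * pi) < of_int k + 1"
    by (auto simp: k_def)
  then have y: "0 \<le> y" "y < 2 * pi"
    by (auto simp: y_def field_simps)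
  have gxy: "g (x - t) = g (y - t)" for t
    using periodic_2pi_shift_int[OF per, of "y - t" k] by (simp add: y_def algebra_simps)
  \<comment> \<open>\<open>p\<close> and \<open>q\<close> are the two pieces of \<open>g\<close>; \<open>q\<close> is read one period to the left.\<close>
  define p where "p s = indicator {-pi + y<..pi} s * g s" for s
  define q where "q s = indicator {-pi<..-pi + y} s * g s" for s
  have gi: "integrable lebesgue (\<lambda>t. indicator {-pi..pi} t * g t)"
    using int by (simp add: integrable_restrict_space)
  have pi1: "integrable lebesgue p"
  proof -
    have "integrable lebesgue (\<lambda>t. indicator {-pi + y<..pi} t *\<^sub>R (indicator {-pi..pi} t * g t))"
      by (rule integrable_mult_indicator[OF _ gi]) simp
    also have "(\<lambda>t. indicator {-pi + y<..pi} t *\<^sub>R (indicator {-pi..pi} t * g t)) = p"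
      using y by (auto simp: p_def fun_eq_iff indicator_def)
    finally show ?thesis .
  qed
  have qi: "integrable lebesgue q"
  proof -
    have "integrable lebesgue (\<lambda>t. indicator {-pi<..-pi + y} t *\<^sub>R (indicator {-pi..pi} t * g t))"
      by (rule integrable_mult_indicator[OF _ gi]) simp
    also have "(\<lambda>t. indicator {-pi<..-pi + y} t *\<^sub>R (indicator {-pi..pi} t * g t)) = q"
      using y by (auto simp: q_def fun_eq_iff indicator_def)
    finally show ?thesis .
  qed
  have p': "integrable lebesgue (\<lambda>t. p (y + (-1) * t))"
    using pi1 by (rule lebesgue_integrable_real_affine) simp
  have q': "integrable lebesgue (\<lambda>t. q ((y - 2 * pi) + (-1) * t))"
    using qi by (rule lebesgue_integrable_real_affine) simp
  have ip: "(LINT t|lebesgue. p (y + (-1) * t)) = integral\<^sup>L lebesgue p"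
    using lebesgue_integral_real_affine[of "-1" p y] by simp
  have iq: "(LINT t|lebesgue. q ((y - 2 * pi) + (-1) * t)) = integral\<^sup>L lebesgue q"
    using lebesgue_integral_real_affine[of "-1" q "y - 2 * pi"] by simp
  have eq: "indicator {-pi..pi} t * g (x - t) = p (y + (-1) * t) + q ((y - 2 * pi) + (-1) * t)"
    if "t \<noteq> pi" for t
  proof -
    have "g (y - t - 2 * pi) = g (y - t)"
      using periodic_2pi_shift_int[OF per, of "y - t" "-1"] by simp
    then show ?thesis
      using that y by (auto simp: gxy p_def q_def indicator_def algebra_simps)
  qed
  have ae: "AE t in lebesgue. p (y + (-1) * t) + q ((y - 2 * pi) + (-1) * t)
      = indicator {-pi..pi} t * g (x - t)"
  proof (rule AE_I[where N = "{pi}"])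
    show "{t \<in> space lebesgue. \<not> p (y + (-1) * t) + q ((y - 2 * pi) + (-1) * t)
      = indicator {-pi..pi} t * g (x - t)} \<subseteq> {pi}"
      using eq by (metis (mono_tags, lifting) mem_Collect_eq singletonI subsetI)
  qed auto
  have m: "(\<lambda>t. p (y + (-1) * t) + q ((y - 2 * pi) + (-1) * t)) \<in> borel_measurable lebesgue"
    using p' q' by measurable
  have m2: "(\<lambda>t. indicator {-pi..pi} t * g (x - t)) \<in> borel_measurable lebesgue"
  proof -
    have "(\<lambda>t. if t \<in> {pi} then indicator {-pi..pi} pi * g (x - pi)
        else p (y + (-1) * t) + q ((y - 2 * pi) + (-1) * t)) \<in> borel_measurable lebesgue"
      using m by (intro measurable_If_set) auto
    also have "(\<lambda>t. if t \<in> {pi} then indicator {-pi..pi} pi * g (x - pi)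
        else p (y + (-1) * t) + q ((y - 2 * pi) + (-1) * t)) = (\<lambda>t. indicator {-pi..pi} t * g (x - t))"
      using eq by (auto simp: fun_eq_iff)
    finally show ?thesis .
  qed
  have i2: "integrable lebesgue (\<lambda>t. indicator {-pi..pi} t * g (x - t))"
    using integrable_cong_AE[OF m m2 ae] Bochner_Integration.integrable_add[OF p' q'] by simp
  then show "integrable circle (\<lambda>t. g (x - t))"
    by (simp add: integrable_restrict_space)
  have "(LINT t|circle. g (x - t)) = (LINT t|lebesgue. indicator {-pi..pi} t * g (x - t))"
    by (simp add: integral_restrict_space)
  also have "\<dots> = (LINT t|lebesgue. p (y + (-1) * t) + q ((y - 2 * pi) + (-1) * t))"
    using integral_cong_AE[OF m m2 ae] by simp
  also have "\<dots> = integral\<^sup>L lebesgue p + integral\<^sup>L lebesgue q"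
    using Bochner_Integration.integral_add[OF p' q'] ip iq by simp
  also have "\<dots> = (LINT t|lebesgue. p t + q t)"
    using Bochner_Integration.integral_add[OF pi1 qi] by simp
  also have "\<dots> = (LINT t|lebesgue. indicator {-pi..pi} t * g t)"
  proof (rule integral_cong_AE)
    show "(\<lambda>t. p t + q t) \<in> borel_measurable lebesgue" using pi1 qi by measurable
    show "(\<lambda>t. indicator {-pi..pi} t * g t) \<in> borel_measurable lebesgue" using gi by measurable
    show "AE t in lebesgue. p t + q t = indicator {-pi..pi} t * g t"
    proof (rule AE_I[where N = "{-pi}"])
      show "{t \<in> space lebesgue. p t + q t \<noteq> indicator {-pi..pi} t * g t} \<subseteq> {-pi}"
        using y by (auto simp: p_def q_def indicator_def)
    qed auto
  qed
  also have "\<dots> = integral\<^sup>L circle g"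
    by (simp add: integral_restrict_space)
  finally show "(LINT t|circle. g (x - t)) = integral\<^sup>L circle g" .
qed

section \<open>The trigonometric system\<close>

text \<open>The trigonometric system in a single sequence \<open>1, sin x, cos x, sin 2x, cos 2x, \<dots>\<close>; the function
with index \<open>i\<close> has degree \<open>Suc i div 2\<close>.\<close>

definition trig :: "nat \<Rightarrow> real \<Rightarrow> real" where
  "trig i x = (if even i then cos (real (i div 2) * x) else sin (real (Suc i div 2) * x))"

lemma continuous_trig [continuous_intros]: "continuous_on A (trig i)"
  unfolding trig_def by (cases "even i") (auto intro!: continuous_intros)

lemma abs_trig_le_1: "\<bar>trig i x\<bar> \<le> 1"
  by (simp add: trig_def)

lemma periodic_trig: "periodic_2pi (trig i)"
proof -
  have "cos (real m * (x + 2 * pi)) = cos (real m * x)" "sin (real m * (x + 2 * pi)) = sin (real m * x)"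
    for m x
  proof -
    have "real m * (x + 2 * pi) = real m * x + 2 * pi * real m" by (simp add: algebra_simps)
    then show "cos (real m * (x + 2 * pi)) = cos (real m * x)" "sin (real m * (x + 2 * pi)) = sin (real m * x)"
      by (simp_all add: cos_add sin_add cos_integer_2pi sin_integer_2pi)
  qed
  then show ?thesis unfolding periodic_2pi_def trig_def by (simp only: if_cancel split: if_split) blast
qed

text \<open>Orthogonality follows from the product formulas as soon as the nontrivial exponentials of degree
at most \<open>h\<close> have mean zero. With a general measure this covers the circle, where \<open>h\<close> is arbitrary,
and equidistant nodes, where \<open>h\<close> is smaller than the number of the nodes.\<close>

lemma trig_orthogonal:
  fixes M :: "'a measure" and x :: "'a \<Rightarrow> real" and h :: nat
  assumes fin: "finite_measure M" and meas [measurable]: "x \<in> borel_measurable M"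
    and C: "\<And>m::int. m \<noteq> 0 \<Longrightarrow> \<bar>m\<bar> \<le> int h \<Longrightarrow> (LINT t|M. cos (of_int m * x t)) = 0"
    and S: "\<And>m::int. \<bar>m\<bar> \<le> int h \<Longrightarrow> (LINT t|M. sin (of_int m * x t)) = 0"
    and deg: "Suc i div 2 + Suc l div 2 \<le> h"
  shows "(LINT t|M. trig i (x t) * trig l (x t)) =
     (if i \<noteq> l then 0 else if i = 0 then measure M (space M) else measure M (space M) / 2)"
proof -
  interpret finite_measure M by (fact fin)
  have bc: "integrable M (\<lambda>t. cos (of_int m * x t))" for m :: int
    by (rule integrable_const_bound[where B = 1]) auto
  have bs: "integrable M (\<lambda>t. sin (of_int m * x t))" for m :: int
    by (rule integrable_const_bound[where B = 1]) auto
  have cc: "cos (real a * y) * cos (real b * y) =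
      (cos (of_int (int a - int b) * y) + cos (of_int (int a + int b) * y)) / 2" for a b y
    by (simp add: cos_times_cos algebra_simps)
  have ss: "sin (real a * y) * sin (real b * y) =
      (cos (of_int (int a - int b) * y) - cos (of_int (int a + int b) * y)) / 2" for a b y
    by (simp add: sin_times_sin algebra_simps)
  have cs: "cos (real a * y) * sin (real b * y) =
      (sin (of_int (int a + int b) * y) - sin (of_int (int a - int b) * y)) / 2" for a b y
    by (simp add: cos_times_sin algebra_simps)
  have sc: "sin (real a * y) * cos (real b * y) =
      (sin (of_int (int a + int b) * y) + sin (of_int (int a - int b) * y)) / 2" for a b y
    by (simp add: sin_times_cos left_diff_distrib distrib_right)
  consider (ee) "even i" "even l" | (oo) "odd i" "odd l" | (eo) "even i" "odd l" | (oe) "odd i" "even l"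
    by blast
  then show ?thesis
  proof cases
    case ee
    then have b: "i div 2 + l div 2 \<le> h" using deg by (auto elim!: evenE)
    have "(LINT t|M. trig i (x t) * trig l (x t)) =
      (LINT t|M. (cos (of_int (int (i div 2) - int (l div 2)) * x t)
         + cos (of_int (int (i div 2) + int (l div 2)) * x t)) / 2)"
      using ee by (simp only: trig_def if_True cc)
    also have "\<dots> = ((LINT t|M. cos (of_int (int (i div 2) - int (l div 2)) * x t))
         + (LINT t|M. cos (of_int (int (i div 2) + int (l div 2)) * x t))) / 2"
      using bc[of "int (i div 2) - int (l div 2)"] bc[of "int (i div 2) + int (l div 2)"] by simp
    also have "\<dots> = (if i \<noteq> l then 0 else if i = 0 then measure M (space M) else measure M (space M) / 2)"
    proof (cases "i = l")
      case True
      then show ?thesis using C[of "int (i div 2) + int (l div 2)"] b ee by (auto elim!: evenE)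
    next
      case False
      then show ?thesis using C[of "int (i div 2) + int (l div 2)"] C[of "int (i div 2) - int (l div 2)"] b ee
        by (auto elim!: evenE)
    qed
    finally show ?thesis .
  next
    case oo
    have "(LINT t|M. trig i (x t) * trig l (x t)) =
      (LINT t|M. (cos (of_int (int (Suc i div 2) - int (Suc l div 2)) * x t)
         - cos (of_int (int (Suc i div 2) + int (Suc l div 2)) * x t)) / 2)"
      using oo by (simp only: trig_def if_False ss)
    also have "\<dots> = ((LINT t|M. cos (of_int (int (Suc i div 2) - int (Suc l div 2)) * x t))
         - (LINT t|M. cos (of_int (int (Suc i div 2) + int (Suc l div 2)) * x t))) / 2"
      using bc[of "int (Suc i div 2) - int (Suc l div 2)"] bc[of "int (Suc i div 2) + int (Suc l div 2)"] by simp
    also have "\<dots> = (if i \<noteq> l then 0 else if i = 0 then measure M (space M) else measure M (space M) / 2)"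
    proof (cases "i = l")
      case True
      then show ?thesis using C[of "int (Suc i div 2) + int (Suc l div 2)"] deg oo by (auto elim!: oddE)
    next
      case False
      then show ?thesis using C[of "int (Suc i div 2) + int (Suc l div 2)"]
          C[of "int (Suc i div 2) - int (Suc l div 2)"] deg oo
        by (auto elim!: oddE)
    qed
    finally show ?thesis .
  next
    case eo
    then have b: "i div 2 + Suc l div 2 \<le> h" using deg by (auto elim!: evenE)
    have "(LINT t|M. trig i (x t) * trig l (x t)) =
      (LINT t|M. (sin (of_int (int (i div 2) + int (Suc l div 2)) * x t)
         - sin (of_int (int (i div 2) - int (Suc l div 2)) * x t)) / 2)"
      using eo by (simp only: trig_def if_True if_False cs)
    also have "\<dots> = ((LINT t|M. sin (of_int (int (i div 2) + int (Suc l div 2)) * x t))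
         - (LINT t|M. sin (of_int (int (i div 2) - int (Suc l div 2)) * x t))) / 2"
      using bs[of "int (i div 2) + int (Suc l div 2)"] bs[of "int (i div 2) - int (Suc l div 2)"] by simp
    also have "\<dots> = 0"
      using S[of "int (i div 2) + int (Suc l div 2)"] S[of "int (i div 2) - int (Suc l div 2)"] b by simp
    finally show ?thesis using eo by auto
  next
    case oe
    then have b: "Suc i div 2 + l div 2 \<le> h" using deg by (auto elim!: evenE)
    have "(LINT t|M. trig i (x t) * trig l (x t)) =
      (LINT t|M. (sin (of_int (int (Suc i div 2) + int (l div 2)) * x t)
         + sin (of_int (int (Suc i div 2) - int (l div 2)) * x t)) / 2)"
      using oe by (simp only: trig_def if_True if_False sc)
    also have "\<dots> = ((LINT t|M. sin (of_int (int (Suc i div 2) + int (l div 2)) * x t))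
         + (LINT t|M. sin (of_int (int (Suc i div 2) - int (l div 2)) * x t))) / 2"
      using bs[of "int (Suc i div 2) + int (l div 2)"] bs[of "int (Suc i div 2) - int (l div 2)"] by simp
    also have "\<dots> = 0"
      using S[of "int (Suc i div 2) + int (l div 2)"] S[of "int (Suc i div 2) - int (l div 2)"] b by simp
    finally show ?thesis using oe by auto
  qed
qed

text \<open>Expand the integral of the square of \<open>v\<close> minus its orthogonal projection.\<close>

lemma bessel_inequality:
  fixes M :: "'a measure" and u :: "nat \<Rightarrow> 'a \<Rightarrow> real" and v :: "'a \<Rightarrow> real"
  assumes fin: "finite I"
    and uu: "\<And>i l. i \<in> I \<Longrightarrow> l \<in> I \<Longrightarrow> integrable M (\<lambda>t. u i t * u l t)"
    and vu: "\<And>i. i \<in> I \<Longrightarrow> integrable M (\<lambda>t. v t * u i t)"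
    and vv: "integrable M (\<lambda>t. (v t)\<^sup>2)"
    and orth: "\<And>i l. i \<in> I \<Longrightarrow> l \<in> I \<Longrightarrow> (LINT t|M. u i t * u l t) = (if i = l then c else 0)"
    and c: "0 < c"
  shows "(\<Sum>i\<in>I. ((LINT t|M. v t * u i t) / c)\<^sup>2) \<le> (LINT t|M. (v t)\<^sup>2) / c"
proof -
  define a where "a i = (LINT t|M. v t * u i t) / c" for i
  have exp: "(v t - (\<Sum>i\<in>I. a i * u i t))\<^sup>2 =
     (v t)\<^sup>2 - 2 * (\<Sum>i\<in>I. a i * (v t * u i t)) + (\<Sum>i\<in>I. \<Sum>l\<in>I. a i * a l * (u i t * u l t))" for t
    unfolding power2_diff
    by (simp add: power2_eq_square sum_product sum_distrib_left mult_ac)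
  have "0 \<le> (LINT t|M. (v t - (\<Sum>i\<in>I. a i * u i t))\<^sup>2)"
    by simp
  also have "\<dots> = (LINT t|M. (v t)\<^sup>2) - 2 * (\<Sum>i\<in>I. a i * (LINT t|M. v t * u i t))
      + (\<Sum>i\<in>I. \<Sum>l\<in>I. a i * a l * (LINT t|M. u i t * u l t))"
    unfolding exp using uu vu vv by (simp add: Bochner_Integration.integral_sum)
  also have "(\<Sum>i\<in>I. \<Sum>l\<in>I. a i * a l * (LINT t|M. u i t * u l t)) = (\<Sum>i\<in>I. c * (a i)\<^sup>2)"
  proof (rule sum.cong[OF refl])
    fix i assume i: "i \<in> I"
    have "(\<Sum>l\<in>I. a i * a l * (LINT t|M. u i t * u l t)) = (\<Sum>l\<in>I. if i = l then c * (a i)\<^sup>2 else 0)"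
      using orth[OF i] by (intro sum.cong) (auto simp: power2_eq_square)
    then show "(\<Sum>l\<in>I. a i * a l * (LINT t|M. u i t * u l t)) = c * (a i)\<^sup>2"
      using fin i by simp
  qed
  also have "(\<Sum>i\<in>I. a i * (LINT t|M. v t * u i t)) = (\<Sum>i\<in>I. c * (a i)\<^sup>2)"
    using c by (intro sum.cong) (auto simp: a_def power2_eq_square)
  finally have "(\<Sum>i\<in>I. c * (a i)\<^sup>2) \<le> (LINT t|M. (v t)\<^sup>2)" by simp
  then have "c * (\<Sum>i\<in>I. (a i)\<^sup>2) \<le> (LINT t|M. (v t)\<^sup>2)" by (simp add: sum_distrib_left)
  then show ?thesis using c unfolding a_def[symmetric] by (simp add: field_simps)
qed

lemma integral_circle_sin: "(LINT t|circle. sin (of_int m * t)) = 0" for m :: int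
proof -
  have "continuous_on UNIV (\<lambda>t. sin (of_int m * t :: real))"
    by (intro continuous_intros)
  then have "integrable circle (\<lambda>t. sin (of_int m * t))"
    by (rule integrable_circle_continuous)
  moreover have "periodic_2pi (\<lambda>t. sin (of_int m * t :: real))"
  proof -
    have "of_int m * (x + 2 * pi) = of_int m * x + 2 * pi * of_int m" for x :: real
      by (simp add: algebra_simps)
    then show ?thesis by (simp add: periodic_2pi_def sin_add)
  qed
  ultimately have "(LINT t|circle. sin (of_int m * (0 - t))) = (LINT t|circle. sin (of_int m * t))"
    by (intro integral_circle_reflect) auto
  then show ?thesis by simp
qed

lemma integral_circle_cos:
  fixes m :: int
  assumes "m \<noteq> 0"
  shows "(LINT t|circle. cos (of_int m * t)) = 0"
proof -
  have i: "integrable circle (\<lambda>t. cos (of_int m * t))"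
    by (intro integrable_circle_continuous continuous_intros)
  have d: "((\<lambda>t. sin (of_int m * t) / of_int m) has_vector_derivative cos (of_int m * t)) (at t within {-pi..pi})" for t
    unfolding has_real_derivative_iff_has_vector_derivative[symmetric]
    using assms by (auto intro!: derivative_eq_intros)
  have "((\<lambda>t. cos (of_int m * t)) has_integral (sin (of_int m * pi) / of_int m - sin (of_int m * (-pi)) / of_int m)) {-pi..pi}"
    using d by (intro fundamental_theorem_of_calculus) auto
  moreover have "(LINT t|circle. cos (of_int m * t)) = integral {-pi..pi} (\<lambda>t. cos (of_int m * t))"
    using i by (intro lebesgue_integral_eq_integral) auto
  ultimately show ?thesis
    by (simp add: integral_unique mult.commute)
qed

section \<open>Completeness of the trigonometric system\<close>

text \<open>The continuous functions \<open>f\<close> on the circle that multiply functions with vanishing Fourier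
coefficients into functions with vanishing Fourier coefficients form a ring, trivially closed under
products. It contains both coordinate functions by the product formulas, so the Stone-Weierstrass
theorem makes it dense.\<close>

lemma fourier_orthogonal_continuous:
  fixes D :: "real \<Rightarrow> real" and h :: "complex \<Rightarrow> real"
  assumes D: "integrable circle D" and zero: "\<And>i. (LINT t|circle. D t * trig i t) = 0"
    and h: "continuous_on UNIV h"
  shows "(LINT t|circle. D t * h (cis t)) = 0"
proof -
  define V where "V = {E. integrable circle E \<and>
    (\<forall>m::int. (LINT t|circle. E t * cos (of_int m * t)) = 0 \<and> (LINT t|circle. E t * sin (of_int m * t)) = 0)}"
  define R where "R = {f::complex \<Rightarrow> real. continuous_on UNIV f \<and> (\<forall>E\<in>V. (\<lambda>t. E t * f (cis t)) \<in> V)}"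
  have cs: "continuous_on UNIV (\<lambda>t. cos (of_int m * t :: real))" "continuous_on UNIV (\<lambda>t. sin (of_int m * t :: real))" for m :: int
    by (intro continuous_intros)+
  have VI: "integrable circle E"
    and Vc: "integrable circle (\<lambda>t. E t * cos (of_int m * t))" and Vs: "integrable circle (\<lambda>t. E t * sin (of_int m * t))"
    and V0: "(LINT t|circle. E t * cos (of_int m * t)) = 0" "(LINT t|circle. E t * sin (of_int m * t)) = 0"
    if "E \<in> V" for E and m :: int
    using that integrable_circle_mult_continuous[of E, OF _ cs(1)[of m]] integrable_circle_mult_continuous[of E, OF _ cs(2)[of m]]
    by (auto simp: V_def)
  have cis: "continuous_on UNIV (\<lambda>t. f (cis t))" if "continuous_on UNIV f" for f :: "complex \<Rightarrow> real"
    using that by (rule continuous_on_compose2) (auto intro!: continuous_intros)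
  have re: "Re \<in> R"
  proof -
    have "(\<lambda>t. E t * Re (cis t)) \<in> V" if E: "E \<in> V" for E
    proof -
      have "integrable circle (\<lambda>t. E t * Re (cis t))"
        by (rule integrable_circle_mult_continuous[OF VI[OF E] cis]) (auto intro!: continuous_intros)
      moreover have "(LINT t|circle. E t * Re (cis t) * cos (of_int m * t)) = 0" for m
      proof -
        have "(LINT t|circle. E t * Re (cis t) * cos (of_int m * t)) =
            (LINT t|circle. (E t * cos (of_int (m + 1) * t) + E t * cos (of_int (m - 1) * t)) / 2)"
          by (rule Bochner_Integration.integral_cong) (simp_all add: cos_add cos_diff algebra_simps)
        also have "\<dots> = 0"
          using Vc[OF E, of "m + 1"] Vc[OF E, of "m - 1"] V0(1)[OF E, of "m + 1"] V0(1)[OF E, of "m - 1"]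
          by (simp del: of_int_add of_int_diff)
        finally show ?thesis .
      qed
      moreover have "(LINT t|circle. E t * Re (cis t) * sin (of_int m * t)) = 0" for m
      proof -
        have "(LINT t|circle. E t * Re (cis t) * sin (of_int m * t)) =
            (LINT t|circle. (E t * sin (of_int (m + 1) * t) + E t * sin (of_int (m - 1) * t)) / 2)"
          by (rule Bochner_Integration.integral_cong) (simp_all add: sin_add sin_diff algebra_simps)
        also have "\<dots> = 0"
          using Vs[OF E, of "m + 1"] Vs[OF E, of "m - 1"] V0(2)[OF E, of "m + 1"] V0(2)[OF E, of "m - 1"]
          by (simp del: of_int_add of_int_diff)
        finally show ?thesis .
      qed
      ultimately show ?thesis
        unfolding V_def by blast
    qed
    then show ?thesis by (auto simp: R_def intro!: continuous_intros)
  qed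
  have im: "Im \<in> R"
  proof -
    have "(\<lambda>t. E t * Im (cis t)) \<in> V" if E: "E \<in> V" for E
    proof -
      have "integrable circle (\<lambda>t. E t * Im (cis t))"
        by (rule integrable_circle_mult_continuous[OF VI[OF E] cis]) (auto intro!: continuous_intros)
      moreover have "(LINT t|circle. E t * Im (cis t) * cos (of_int m * t)) = 0" for m
      proof -
        have "(LINT t|circle. E t * Im (cis t) * cos (of_int m * t)) =
            (LINT t|circle. (E t * sin (of_int (m + 1) * t) - E t * sin (of_int (m - 1) * t)) / 2)"
          by (rule Bochner_Integration.integral_cong) (simp_all add: sin_add sin_diff algebra_simps)
        also have "\<dots> = 0"
          using Vs[OF E, of "m + 1"] Vs[OF E, of "m - 1"] V0(2)[OF E, of "m + 1"] V0(2)[OF E, of "m - 1"]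
          by (simp del: of_int_add of_int_diff)
        finally show ?thesis .
      qed
      moreover have "(LINT t|circle. E t * Im (cis t) * sin (of_int m * t)) = 0" for m
      proof -
        have "(LINT t|circle. E t * Im (cis t) * sin (of_int m * t)) =
            (LINT t|circle. (E t * cos (of_int (m - 1) * t) - E t * cos (of_int (m + 1) * t)) / 2)"
          by (rule Bochner_Integration.integral_cong) (simp_all add: cos_add cos_diff algebra_simps)
        also have "\<dots> = 0"
          using Vc[OF E, of "m + 1"] Vc[OF E, of "m - 1"] V0(1)[OF E, of "m + 1"] V0(1)[OF E, of "m - 1"]
          by (simp del: of_int_add of_int_diff)
        finally show ?thesis .
      qed
      ultimately show ?thesis
        unfolding V_def by blast
    qed
    then show ?thesis by (auto simp: R_def intro!: continuous_intros)
  qed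
  interpret function_ring_on R "sphere 0 1"
  proof
    show "compact (sphere 0 (1::real) :: complex set)" by simp
    show "continuous_on (sphere 0 1) f" if "f \<in> R" for f
      using that by (auto simp: R_def intro: continuous_on_subset)
    show "(\<lambda>x. f x + g x) \<in> R" if "f \<in> R" "g \<in> R" for f g
    proof -
      have "(\<lambda>t. E t * (f (cis t) + g (cis t))) \<in> V" if E: "E \<in> V" for E
      proof -
        have f: "(\<lambda>t. E t * f (cis t)) \<in> V" and g: "(\<lambda>t. E t * g (cis t)) \<in> V"
          using \<open>f \<in> R\<close> \<open>g \<in> R\<close> E by (auto simp: R_def)
        show ?thesis
          using VI[OF f] VI[OF g] V0[OF f] V0[OF g] Vc[OF f] Vc[OF g] Vs[OF f] Vs[OF g]
          unfolding V_def by (simp add: distrib_left distrib_right)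
      qed
      then show ?thesis using that by (auto simp: R_def intro!: continuous_intros)
    qed
    show "(\<lambda>x. f x * g x) \<in> R" if fg: "f \<in> R" "g \<in> R" for f g
    proof -
      have "(\<lambda>t. E t * (f (cis t) * g (cis t))) \<in> V" if E: "E \<in> V" for E
      proof -
        have "(\<lambda>t. E t * f (cis t)) \<in> V" using fg E by (auto simp: R_def)
        then have "(\<lambda>t. (E t * f (cis t)) * g (cis t)) \<in> V" using fg by (auto simp: R_def)
        then show ?thesis by (simp add: mult.assoc)
      qed
      then show ?thesis using fg by (auto simp: R_def intro!: continuous_intros)
    qed
    show "(\<lambda>_. c) \<in> R" for c
    proof -
      have "(\<lambda>t. E t * c) \<in> V" if E: "E \<in> V" for E
      proof -
        have "(\<lambda>t. E t * c * cos (of_int m * t)) = (\<lambda>t. c * (E t * cos (of_int m * t)))"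
          "(\<lambda>t. E t * c * sin (of_int m * t)) = (\<lambda>t. c * (E t * sin (of_int m * t)))" for m :: int
          by auto
        then show ?thesis using VI[OF E] V0[OF E] unfolding V_def by simp
      qed
      then show ?thesis by (auto simp: R_def)
    qed
    show "\<exists>f\<in>R. f x \<noteq> f y" if "x \<noteq> y" for x y
      using that re im complex_eq_iff by blast
  qed
  have DV: "D \<in> V"
  proof -
    have "(LINT t|circle. D t * cos (of_int m * t)) = 0 \<and> (LINT t|circle. D t * sin (of_int m * t)) = 0" for m :: int
    proof -
      define k where "k = nat \<bar>m\<bar>"
      have c: "(LINT t|circle. D t * cos (real k * t)) = 0"
        using zero[of "2 * k"] by (simp add: trig_def)
      have s: "(LINT t|circle. D t * sin (real k * t)) = 0"
      proof (cases k)
        case (Suc j)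
        then show ?thesis using zero[of "Suc (2 * j)"] by (simp add: trig_def)
      qed simp
      show ?thesis
      proof (cases "m \<ge> 0")
        case True
        then have "of_int m = real k" by (simp add: k_def)
        then show ?thesis using c s by simp
      next
        case False
        then have "of_int m = - real k" by (simp add: k_def)
        then show ?thesis using c s by simp
      qed
    qed
    then show ?thesis using D by (simp add: V_def)
  qed
  have Dh: "integrable circle (\<lambda>t. D t * h (cis t))"
    by (rule integrable_circle_mult_continuous[OF D cis[OF h]])
  define J where "J = (LINT t|circle. \<bar>D t\<bar>)"
  have J: "0 \<le> J" by (simp add: J_def)
  \<comment> \<open>The denominator \<open>J + 1\<close> avoids a division by zero when \<open>D\<close> vanishes almost everywhere.\<close>
  have "\<bar>LINT t|circle. D t * h (cis t)\<bar> \<le> e" if e: "e > 0" for e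
  proof -
    have e': "e / (J + 1) > 0" using e J by simp
    obtain g where g: "g \<in> R" and gh: "\<And>z. z \<in> sphere 0 1 \<Longrightarrow> \<bar>h z - g z\<bar> < e / (J + 1)"
      using Stone_Weierstrass_basic[OF continuous_on_subset[OF h] e'] by auto
    have gc: "continuous_on UNIV g" and gV: "(\<lambda>t. D t * g (cis t)) \<in> V" using g DV by (auto simp: R_def)
    have Dg: "integrable circle (\<lambda>t. D t * g (cis t))" using VI[OF gV] .
    have g0: "(LINT t|circle. D t * g (cis t)) = 0" using V0(1)[OF gV, of 0] by simp
    have "(LINT t|circle. D t * h (cis t)) = (LINT t|circle. D t * h (cis t) - D t * g (cis t))"
      using Dh Dg g0 by simp
    also have "\<bar>\<dots>\<bar> \<le> (LINT t|circle. \<bar>D t * h (cis t) - D t * g (cis t)\<bar>)"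
      using integral_norm_bound[of circle "\<lambda>t. D t * h (cis t) - D t * g (cis t)"] by simp
    also have "\<dots> \<le> (LINT t|circle. \<bar>D t\<bar> * (e / (J + 1)))"
    proof (rule integral_mono)
      show "integrable circle (\<lambda>t. \<bar>D t * h (cis t) - D t * g (cis t)\<bar>)" using Dh Dg by simp
      show "integrable circle (\<lambda>t. \<bar>D t\<bar> * (e / (J + 1)))" using D by simp
      fix t
      have "\<bar>h (cis t) - g (cis t)\<bar> \<le> e / (J + 1)" using gh[of "cis t"] by simp
      then show "\<bar>D t * h (cis t) - D t * g (cis t)\<bar> \<le> \<bar>D t\<bar> * (e / (J + 1))"
        unfolding right_diff_distrib[symmetric] abs_mult by (rule mult_left_mono) simp
    qed
    also have "\<dots> = J * (e / (J + 1))" using D by (simp add: J_def)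
    also have "\<dots> \<le> e" using e J by (simp add: field_simps)
    finally show ?thesis .
  qed
  then show ?thesis using field_le_epsilon[of "\<bar>LINT t|circle. D t * h (cis t)\<bar>" 0] by simp
qed

lemma cis_inj_on_circle:
  assumes "cis s = cis t" "s \<in> {-pi<..<pi}" "t \<in> {-pi..pi}"
  shows "s = t"
proof -
  have "Arg (cis s) = s" using assms by (intro cis_Arg_unique) auto
  moreover have "Arg (cis t) = t \<or> t = -pi"
    using assms(3) by (cases "t = -pi") (auto intro!: cis_Arg_unique)
  moreover have "Arg (cis (-pi)) = pi"
    by (rule cis_Arg_unique) (auto simp: complex_eq_iff)
  ultimately show ?thesis using assms by auto
qed

text \<open>The indicator of a closed arc is the bounded pointwise limit of continuous functions of the
distance to the arc. The interval avoids the endpoints, which \<^term>\<open>cis\<close> identifies.\<close>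

lemma fourier_orthogonal_interval:
  fixes D :: "real \<Rightarrow> real"
  assumes D: "integrable circle D" and zero: "\<And>i. (LINT t|circle. D t * trig i t) = 0"
    and ab: "-pi < a" "a \<le> b" "b < pi"
  shows "integral {a..b} D = 0"
proof -
  define Z where "Z = cis ` {a..b}"
  have cZ: "closed Z" unfolding Z_def
    by (intro compact_imp_closed compact_continuous_image continuous_intros) auto
  have neZ: "Z \<noteq> {}" using ab by (auto simp: Z_def)
  define h where "h m z = max 0 (1 - real m * infdist z Z)" for m z
  have hc: "continuous_on UNIV (h m)" for m unfolding h_def by (intro continuous_intros)
  have hcis: "continuous_on UNIV (\<lambda>t. h m (cis t))" for m
    by (rule continuous_on_compose2[OF hc]) (auto intro!: continuous_intros)
  have lim: "(\<lambda>m. h m z) \<longlonglongrightarrow> indicator Z z" for z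
  proof (cases "z \<in> Z")
    case True
    then show ?thesis by (simp add: h_def)
  next
    case False
    then have pos: "infdist z Z > 0" using infdist_pos_not_in_closed[OF cZ neZ] by blast
    obtain m0 :: nat where m0: "1 / infdist z Z < real m0" using reals_Archimedean2 by blast
    have "h m z = 0" if "m \<ge> m0" for m
    proof -
      have "1 / infdist z Z < real m" using m0 that by linarith
      then have "1 < real m * infdist z Z" using pos by (simp add: field_simps)
      then show ?thesis by (simp add: h_def)
    qed
    then have "\<forall>\<^sub>F m in sequentially. h m z = 0" by (auto simp: eventually_sequentially)
    then have "(\<lambda>m. h m z) \<longlonglongrightarrow> 0" by (rule tendsto_eventually)
    then show ?thesis using False by simp
  qed
  have dc: "(\<lambda>m. LINT t|circle. D t * h m (cis t)) \<longlonglongrightarrow> (LINT t|circle. D t * indicator Z (cis t))"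
  proof (rule integral_dominated_convergence[where w = "\<lambda>t. \<bar>D t\<bar>"])
    show "(\<lambda>t. D t * indicator Z (cis t)) \<in> borel_measurable circle"
    proof (rule borel_measurable_LIMSEQ_real)
      show "(\<lambda>t. D t * h m (cis t)) \<in> borel_measurable circle" for m
        using integrable_circle_mult_continuous[OF D hcis] by (rule borel_measurable_integrable)
      show "(\<lambda>m. D t * h m (cis t)) \<longlonglongrightarrow> D t * indicator Z (cis t)" for t
        by (intro tendsto_intros lim)
    qed
    show "(\<lambda>t. D t * h m (cis t)) \<in> borel_measurable circle" for m
      using integrable_circle_mult_continuous[OF D hcis] by (rule borel_measurable_integrable)
    show "integrable circle (\<lambda>t. \<bar>D t\<bar>)" using D by simp
    show "AE t in circle. (\<lambda>m. D t * h m (cis t)) \<longlonglongrightarrow> D t * indicator Z (cis t)"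
      by (intro AE_I2 tendsto_intros lim)
    show "AE t in circle. norm (D t * h m (cis t)) \<le> \<bar>D t\<bar>" for m
    proof (rule AE_I2)
      fix t
      have "\<bar>h m (cis t)\<bar> \<le> 1" by (auto simp: h_def infdist_nonneg)
      then show "norm (D t * h m (cis t)) \<le> \<bar>D t\<bar>"
        by (simp add: abs_mult mult_left_le)
    qed
  qed
  have "(LINT t|circle. D t * h m (cis t)) = 0" for m
    by (rule fourier_orthogonal_continuous[OF D zero hc])
  then have z: "(LINT t|circle. D t * indicator Z (cis t)) = 0"
    using LIMSEQ_unique[OF dc] by simp
  have ind: "indicator Z (cis t) = (indicator {a..b} t :: real)" if "t \<in> {-pi..pi}" for t
  proof (cases "t \<in> {a..b}")
    case False
    have "cis t \<notin> Z"
    proof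
      assume "cis t \<in> Z"
      then obtain s where s: "s \<in> {a..b}" "cis t = cis s" by (auto simp: Z_def)
      then have "s = t" using that ab by (intro cis_inj_on_circle) auto
      then show False using s False by simp
    qed
    then show ?thesis using False by simp
  qed (simp add: Z_def)
  have sub: "{a..b} \<subseteq> {-pi..pi}" using ab by auto
  have Dab: "integrable (lebesgue_on {a..b}) D"
  proof -
    have "set_integrable lebesgue {a..b} D"
      by (rule set_integrable_subset[of _ "{-pi..pi}"]) (use D sub set_integrable_circle in auto)
    then show ?thesis by (simp add: set_integrable_def integrable_restrict_space)
  qed
  have "integral {a..b} D = (LINT t|lebesgue_on {a..b}. D t)"
    using Dab by (simp add: lebesgue_integral_eq_integral)
  also have "\<dots> = (LINT t|lebesgue. indicator {a..b} t * D t)"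
    by (simp add: integral_restrict_space)
  also have "\<dots> = (LINT t|lebesgue. indicator {-pi..pi} t * (D t * indicator Z (cis t)))"
  proof (rule Bochner_Integration.integral_cong[OF refl])
    fix t
    show "indicator {a..b} t * D t = indicator {-pi..pi} t * (D t * indicator Z (cis t))"
      using ind[of t] sub by (cases "t \<in> {-pi..pi}") (auto simp: mult.commute indicator_def)
  qed
  also have "\<dots> = 0" using z by (simp add: integral_restrict_space)
  finally show ?thesis .
qed

text \<open>Almost everywhere a function is the limit of its averages over small intervals, and these vanish.\<close>

theorem fourier_uniqueness:
  fixes D :: "real \<Rightarrow> real"
  assumes D: "integrable circle D" and zero: "\<And>i. (LINT t|circle. D t * trig i t) = 0"
  shows "AE t in circle. D t = 0"
proof -
  define f where "f t = indicator {-pi..pi} t * D t" for t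
  have fi: "integrable lebesgue f"
    using D by (simp add: integrable_restrict_space f_def[abs_def])
  have fab: "f integrable_on cbox a b" for a b
    using integrable_on_subcbox[OF integrable_on_lebesgue[OF fi]] by simp
  obtain N where N: "negligible N"
    and Nlim: "\<And>x e. \<lbrakk>x \<notin> N; 0 < e\<rbrakk> \<Longrightarrow> \<exists>d>0. \<forall>h. 0 < h \<and> h < d \<longrightarrow>
       norm (integral (cbox x (x + h *\<^sub>R One)) f /\<^sub>R h ^ DIM(real) - f x) < e"
    using integrable_ccontinuous_explicit[OF fab] by blast
  have z: "D x = 0" if x: "x \<notin> N" "x \<in> {-pi<..<pi}" for x
  proof (rule ccontr)
    assume "D x \<noteq> 0"
    then have "\<bar>D x\<bar> > 0" by simp
    from Nlim[OF x(1) this] obtain d where d: "d > 0"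
      and dl: "\<And>h. 0 < h \<and> h < d \<Longrightarrow> norm (integral {x..x + h} f / h - f x) < \<bar>D x\<bar>"
      by (auto simp: divide_inverse_commute)
    \<comment> \<open>Short enough for the averaging interval to stay inside \<open>{-pi<..<pi}\<close>.\<close>
    define h where "h = min (d / 2) ((pi - x) / 2)"
    have h: "0 < h" "h < d" "x + h < pi" using d x by (auto simp: h_def min_def field_simps)
    have "integral {x..x + h} f = integral {x..x + h} D"
      using h x by (intro integral_cong) (auto simp: f_def)
    also have "\<dots> = 0" using h x by (intro fourier_orthogonal_interval[OF D zero]) auto
    finally show False using dl[of h] h x by (simp add: f_def)
  qed
  have "negligible (N \<union> {-pi, pi})" using N by simp
  then have nul: "N \<union> {-pi, pi} \<in> null_sets lebesgue" by (simp add: negligible_iff_null_sets)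
  have "AE t in lebesgue. t \<in> {-pi..pi} \<longrightarrow> D t = 0"
  proof (rule AE_I'[OF nul])
    show "{t \<in> space lebesgue. \<not> (t \<in> {-pi..pi} \<longrightarrow> D t = 0)} \<subseteq> N \<union> {-pi, pi}"
      using z by force
  qed
  then show ?thesis by (subst AE_restrict_space_iff) auto
qed

section \<open>The kernel and the convolution class\<close>

lemma trig_orthogonal_circle:
  "(LINT t|circle. trig i t * trig l t) = (if i \<noteq> l then 0 else if i = 0 then 2 * pi else pi)"
proof -
  have "(\<lambda>t. t) \<in> borel_measurable circle"
    using integrable_circle_continuous[of "\<lambda>t. t"] by (intro borel_measurable_integrable) auto
  from trig_orthogonal[OF finite_measure_circle this, of "Suc i div 2 + Suc l div 2" i l]
  show ?thesis using integral_circle_cos integral_circle_sin measure_circle by simp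
qed

lemma integrable_circle_trig_mult: "integrable circle (\<lambda>t. trig i t * trig l t)"
  by (intro integrable_circle_continuous continuous_intros)

lemma sum_pairs: "(\<Sum>i\<in>{1..2 * n}. F i) = (\<Sum>k\<in>{1..n}. F (2 * k - 1) + F (2 * k))"
  for F :: "nat \<Rightarrow> real"
  by (induction n) auto

lemma L2_periodicD:
  assumes "f \<in> L2_periodic"
  shows "periodic_2pi f" "f \<in> borel_measurable circle" "integrable circle (\<lambda>t. (f t)\<^sup>2)" "integrable circle f"
proof -
  show "periodic_2pi f" using assms by (simp add: L2_periodic_def)
  show m: "f \<in> borel_measurable circle" using assms
    by (simp add: L2_periodic_def measurable_restrict_space1)
  show i: "integrable circle (\<lambda>t. (f t)\<^sup>2)" using assms by (simp add: L2_periodic_def set_integrable_circle)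
  show "integrable circle f" by (rule integrable_circle_of_square[OF m i])
qed

lemma L2_periodicI:
  assumes "periodic_2pi f" "continuous_on UNIV f"
  shows "f \<in> L2_periodic"
proof -
  have "f \<in> borel_measurable borel" using assms(2) by (rule borel_measurable_continuous_onI)
  then have "f \<in> borel_measurable lebesgue"
    by (intro measurable_completion) simp
  moreover have "integrable circle (\<lambda>t. (f t)\<^sup>2)"
    by (intro integrable_circle_continuous continuous_intros assms)
  ultimately show ?thesis using assms by (simp add: L2_periodic_def set_integrable_circle)
qed

text \<open>The Fourier coefficients of \<open>\<psi> k * cos (k * t - \<beta> k * pi / 2)\<close> along \<^const>\<open>trig\<close>.\<close>

definition kernel_coeff :: "(nat \<Rightarrow> real) \<Rightarrow> (nat \<Rightarrow> real) \<Rightarrow> nat \<Rightarrow> real" where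
  "kernel_coeff \<psi> \<beta> i = (let k = Suc i div 2 in
     if i = 0 then 0 else \<psi> k * (if even i then cos (\<beta> k * pi / 2) else sin (\<beta> k * pi / 2)))"

lemma fourier_cos_coeff_trig: "fourier_cos_coeff f k = (LINT t|circle. f t * trig (2 * k) t) / pi"
  by (simp add: fourier_cos_coeff_def set_integral_circle trig_def)

lemma fourier_sin_coeff_trig:
  "k \<ge> 1 \<Longrightarrow> fourier_sin_coeff f k = (LINT t|circle. f t * trig (2 * k - 1) t) / pi"
  by (cases k) (simp_all add: fourier_sin_coeff_def set_integral_circle trig_def)

lemma harmonic_eqI:
  assumes k: "k \<ge> 1" and eq: "\<And>t. a * cos (real k * t) + b * sin (real k * t) = c * cos (real k * t) + d * sin (real k * t)"
  shows "a = c \<and> b = d"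
proof -
  have h: "real k * (pi / (2 * real k)) = pi / 2" using k by simp
  show ?thesis using eq[of 0] eq[of "pi / (2 * real k)"] unfolding h by simp
qed

text \<open>A harmonic of positive degree determines its two coefficients, so equality of the terms of the
Fourier series for all arguments amounts to equality of the coefficients.\<close>

lemma is_kernel_iff_trig:
  "is_kernel \<psi> \<beta> \<Psi> \<longleftrightarrow> \<Psi> \<in> L2_periodic \<and> (\<forall>i. (LINT t|circle. \<Psi> t * trig i t) = pi * kernel_coeff \<psi> \<beta> i)"
proof -
  have kc: "kernel_coeff \<psi> \<beta> (2 * k) = \<psi> k * cos (\<beta> k * pi / 2)"
    "kernel_coeff \<psi> \<beta> (2 * k - 1) = \<psi> k * sin (\<beta> k * pi / 2)" if "k \<ge> 1" for k
    using that by (auto simp: kernel_coeff_def Let_def)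
  have *: "(\<forall>t. fourier_term \<Psi> k t = \<psi> k * cos (real k * t - \<beta> k * pi / 2)) \<longleftrightarrow>
     (LINT t|circle. \<Psi> t * trig (2 * k) t) = pi * kernel_coeff \<psi> \<beta> (2 * k) \<and>
     (LINT t|circle. \<Psi> t * trig (2 * k - 1) t) = pi * kernel_coeff \<psi> \<beta> (2 * k - 1)" if k: "k \<ge> 1" for k
  proof -
    have "(\<forall>t. fourier_term \<Psi> k t = \<psi> k * cos (real k * t - \<beta> k * pi / 2)) \<longleftrightarrow>
      (\<forall>t. fourier_cos_coeff \<Psi> k * cos (real k * t) + fourier_sin_coeff \<Psi> k * sin (real k * t) =
        kernel_coeff \<psi> \<beta> (2 * k) * cos (real k * t) + kernel_coeff \<psi> \<beta> (2 * k - 1) * sin (real k * t))"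
    proof -
      have "\<psi> k * cos (real k * t - \<beta> k * pi / 2) = kernel_coeff \<psi> \<beta> (2 * k) * cos (real k * t)
          + kernel_coeff \<psi> \<beta> (2 * k - 1) * sin (real k * t)" for t
        unfolding kc[OF k] cos_diff by (simp add: algebra_simps)
      then show ?thesis using k by (simp add: fourier_term_def)
    qed
    also have "\<dots> \<longleftrightarrow> fourier_cos_coeff \<Psi> k = kernel_coeff \<psi> \<beta> (2 * k) \<and> fourier_sin_coeff \<Psi> k = kernel_coeff \<psi> \<beta> (2 * k - 1)"
      using harmonic_eqI[OF k] by metis
    finally show ?thesis
      using k by (simp add: fourier_cos_coeff_trig fourier_sin_coeff_trig field_simps)
  qed
  have "(\<forall>t. fourier_term \<Psi> 0 t = 0) \<longleftrightarrow> (LINT t|circle. \<Psi> t * trig 0 t) = pi * kernel_coeff \<psi> \<beta> 0"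
    by (simp add: fourier_term_def fourier_cos_coeff_trig kernel_coeff_def)
  note zero = this
  have by_degree: "(\<forall>i. Q i) \<longleftrightarrow> Q 0 \<and> (\<forall>k\<ge>1. Q (2 * k) \<and> Q (2 * k - 1))" for Q :: "nat \<Rightarrow> bool"
  proof -
    have "Q i" if "Q 0" "\<And>k. k \<ge> 1 \<Longrightarrow> Q (2 * k) \<and> Q (2 * k - 1)" for i
    proof (cases "i = 0")
      case False
      show ?thesis
      proof (cases "even i")
        case True
        then show ?thesis using that(2)[of "i div 2"] False by auto
      next
        case False
        then show ?thesis using that(2)[of "Suc i div 2"] by (auto elim!: oddE)
      qed
    qed (use that in simp)
    then show ?thesis by blast
  qed
  show ?thesis
    unfolding is_kernel_def zero by_degree[of "\<lambda>i. (LINT t|circle. \<Psi> t * trig i t) = pi * kernel_coeff \<psi> \<beta> i"]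
    using * by simp
qed

definition kernel_series :: "(nat \<Rightarrow> real) \<Rightarrow> (nat \<Rightarrow> real) \<Rightarrow> real \<Rightarrow> real" where
  "kernel_series \<psi> \<beta> t = (\<Sum>k. \<psi> (Suc k) * cos (real (Suc k) * t - \<beta> (Suc k) * pi / 2))"

lemma integral_circle_mult_series:
  fixes g :: "real \<Rightarrow> real"
  assumes g: "integrable circle g" and h: "\<And>k. continuous_on UNIV (h k)"
    and b: "\<And>k t. \<bar>h k t\<bar> \<le> b k" "summable b"
  shows "(\<lambda>k. LINT t|circle. g t * h k t) sums (LINT t|circle. g t * (\<Sum>k. h k t))"
proof -
  have i: "integrable circle (\<lambda>t. g t * h k t)" for k
    by (rule integrable_circle_mult_continuous[OF g h])
  have bound: "\<bar>g t * h k t\<bar> \<le> \<bar>g t\<bar> * b k" for k t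
    using b(1)[of k t] by (simp add: abs_mult mult_left_mono)
  have s: "summable (\<lambda>k. \<bar>g t\<bar> * b k)" for t
    using b(2) by (rule summable_mult)
  have sn: "summable (\<lambda>k. norm (g t * h k t))" for t
    by (rule summable_comparison_test'[OF s[of t], of 0]) (use bound in auto)
  have sums: "(\<lambda>k. LINT t|circle. g t * h k t) sums (LINT t|circle. (\<Sum>k. g t * h k t))"
  proof (rule sums_integral[OF i])
    show "AE t in circle. summable (\<lambda>k. norm (g t * h k t))" using sn by simp
    show "summable (\<lambda>k. LINT t|circle. norm (g t * h k t))"
    proof (rule summable_comparison_test'[where N = 0])
      show "summable (\<lambda>k. (LINT t|circle. \<bar>g t\<bar>) * b k)" using b(2) by (rule summable_mult)
      show "norm (LINT t|circle. norm (g t * h k t)) \<le> (LINT t|circle. \<bar>g t\<bar>) * b k" for k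
      proof -
        have "(LINT t|circle. norm (g t * h k t)) \<le> (LINT t|circle. \<bar>g t\<bar> * b k)"
          using g i[of k] bound[of _ k] by (intro integral_mono) auto
        then show ?thesis using g by simp
      qed
    qed
  qed
  have "(\<Sum>k. g t * h k t) = g t * (\<Sum>k. h k t)" for t
  proof (rule suminf_mult)
    show "summable (\<lambda>k. h k t)"
      by (rule summable_comparison_test'[OF b(2), of 0]) (use b(1) in auto)
  qed
  then show ?thesis using sums by simp
qed

text \<open>Only the Fourier coefficients of the kernel enter a convolution with a trigonometric polynomial.\<close>

lemma convolution_trig_polynomial:
  assumes ker: "is_kernel \<psi> \<beta> \<Psi>"
  shows "(LINT t|circle. (\<Sum>k\<in>{1..n}. A k * cos (real k * (x - t)) + B k * sin (real k * (x - t))) * \<Psi> t) / pi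
    = (\<Sum>k\<in>{1..n}. \<psi> k * (A k * cos (real k * x - \<beta> k * pi / 2) + B k * sin (real k * x - \<beta> k * pi / 2)))"
proof -
  have L2: "\<Psi> \<in> L2_periodic" and co: "(LINT t|circle. \<Psi> t * trig i t) = pi * kernel_coeff \<psi> \<beta> i" for i
    using ker by (auto simp: is_kernel_iff_trig)
  have i: "integrable circle (\<lambda>t. \<Psi> t * trig i t)" for i
    by (intro integrable_circle_mult_continuous L2_periodicD L2 continuous_intros)
  have tm: "(LINT t|circle. (A k * cos (real k * (x - t)) + B k * sin (real k * (x - t))) * \<Psi> t)
     = pi * (\<psi> k * (A k * cos (real k * x - \<beta> k * pi / 2) + B k * sin (real k * x - \<beta> k * pi / 2)))"
   "integrable circle (\<lambda>t. (A k * cos (real k * (x - t)) + B k * sin (real k * (x - t))) * \<Psi> t)"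
    if k: "k \<in> {1..n}" for k
  proof -
    let ?C = "\<lambda>t. trig (2 * k) t" and ?S = "\<lambda>t. trig (2 * k - 1) t"
    have CS: "?C t = cos (real k * t)" "?S t = sin (real k * t)" for t
      using k by (auto simp: trig_def)
    have kc: "kernel_coeff \<psi> \<beta> (2 * k) = \<psi> k * cos (\<beta> k * pi / 2)"
      "kernel_coeff \<psi> \<beta> (2 * k - 1) = \<psi> k * sin (\<beta> k * pi / 2)"
      using k by (auto simp: kernel_coeff_def Let_def)
    have eq: "(\<lambda>t. (A k * cos (real k * (x - t)) + B k * sin (real k * (x - t))) * \<Psi> t) =
      (\<lambda>t. (A k * cos (real k * x) + B k * sin (real k * x)) * (\<Psi> t * ?C t)
         + (A k * sin (real k * x) - B k * cos (real k * x)) * (\<Psi> t * ?S t))"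
      unfolding CS by (rule ext) (simp add: right_diff_distrib cos_diff sin_diff algebra_simps)
    show "integrable circle (\<lambda>t. (A k * cos (real k * (x - t)) + B k * sin (real k * (x - t))) * \<Psi> t)"
      unfolding eq using i by simp
    have "(LINT t|circle. (A k * cos (real k * (x - t)) + B k * sin (real k * (x - t))) * \<Psi> t) =
      (A k * cos (real k * x) + B k * sin (real k * x)) * (pi * kernel_coeff \<psi> \<beta> (2 * k))
      + (A k * sin (real k * x) - B k * cos (real k * x)) * (pi * kernel_coeff \<psi> \<beta> (2 * k - 1))"
      unfolding eq using i co by simp
    then show "(LINT t|circle. (A k * cos (real k * (x - t)) + B k * sin (real k * (x - t))) * \<Psi> t)
     = pi * (\<psi> k * (A k * cos (real k * x - \<beta> k * pi / 2) + B k * sin (real k * x - \<beta> k * pi / 2)))"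
      unfolding kc by (simp add: cos_diff sin_diff algebra_simps)
  qed
  show ?thesis
    using tm by (simp add: sum_distrib_right Bochner_Integration.integral_sum sum_distrib_left[symmetric])
qed

text \<open>Up to a rotation by \<open>\<beta> k * pi / 2\<close>, each harmonic is the image under the convolution of the same
harmonic with its amplitude divided by \<open>\<psi> k\<close>. The bound says that the sum of these
preimages has norm at most \<open>1\<close>.\<close>

lemma trig_polynomial_mem_conv_class:
  assumes pos: "\<And>k. k \<ge> 1 \<Longrightarrow> 0 < \<psi> k" and ker: "is_kernel \<psi> \<beta> \<Psi>"
    and f: "\<And>x. f x = (\<Sum>i\<le>2 * n. c i * trig i x)"
    and bound: "(\<Sum>i\<in>{1..2 * n}. (c i / \<psi> (Suc i div 2))\<^sup>2) \<le> 1 / pi"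
  shows "f \<in> conv_class \<psi> \<beta>"
proof -
  define \<gamma> where "\<gamma> k = \<beta> k * pi / 2" for k
  \<comment> \<open>\<open>A\<close> and \<open>B\<close> solve the rotation that the phase \<open>\<gamma> k\<close> imposes on the harmonic of degree \<open>k\<close>.\<close>
  define A where "A k = (c (2 * k) * cos (\<gamma> k) + c (2 * k - 1) * sin (\<gamma> k)) / \<psi> k" for k
  define B where "B k = (c (2 * k - 1) * cos (\<gamma> k) - c (2 * k) * sin (\<gamma> k)) / \<psi> k" for k
  define d where "d i = (if even i then A (Suc i div 2) else B (Suc i div 2))" for i
  define \<phi> where "\<phi> t = (\<Sum>k\<in>{1..n}. A k * cos (real k * t) + B k * sin (real k * t))" for t
  have \<phi>: "\<phi> t = (\<Sum>i\<in>{1..2 * n}. d i * trig i t)" for t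
  proof -
    have "d (2 * k - 1) * trig (2 * k - 1) t + d (2 * k) * trig (2 * k) t = A k * cos (real k * t) + B k * sin (real k * t)"
      if "k \<in> {1..n}" for k using that by (simp add: d_def trig_def)
    then show ?thesis unfolding sum_pairs \<phi>_def by (intro sum.cong) auto
  qed
  have per: "periodic_2pi g" if "\<And>x. g x = (\<Sum>i\<in>I. w i * trig i x)" for g :: "real \<Rightarrow> real" and w I
    using periodic_trig that by (simp add: periodic_2pi_def)
  have cont: "continuous_on UNIV \<phi>" unfolding \<phi>_def by (intro continuous_intros)
  have L2: "\<phi> \<in> L2_periodic" by (rule L2_periodicI[OF per[OF \<phi>] cont])
  have "(\<phi> t)\<^sup>2 = (\<Sum>i\<in>{1..2 * n}. \<Sum>l\<in>{1..2 * n}. d i * d l * (trig i t * trig l t))" for t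
    unfolding \<phi> by (simp add: power2_eq_square sum_product mult_ac)
  then have "(LINT t|circle. (\<phi> t)\<^sup>2) = (\<Sum>i\<in>{1..2 * n}. \<Sum>l\<in>{1..2 * n}. d i * d l * (LINT t|circle. trig i t * trig l t))"
    using integrable_circle_trig_mult by (simp add: Bochner_Integration.integral_sum)
  also have "\<dots> = (\<Sum>i\<in>{1..2 * n}. \<Sum>l\<in>{1..2 * n}. if i = l then pi * (d i)\<^sup>2 else 0)"
    by (intro sum.cong) (auto simp: trig_orthogonal_circle power2_eq_square)
  also have "\<dots> = pi * (\<Sum>i\<in>{1..2 * n}. (d i)\<^sup>2)" by (simp add: sum_distrib_left)
  also have "(\<Sum>i\<in>{1..2 * n}. (d i)\<^sup>2) = (\<Sum>i\<in>{1..2 * n}. (c i / \<psi> (Suc i div 2))\<^sup>2)"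
  proof -
    have "(d (2 * k - 1))\<^sup>2 + (d (2 * k))\<^sup>2 =
        (c (2 * k - 1) / \<psi> (Suc (2 * k - 1) div 2))\<^sup>2 + (c (2 * k) / \<psi> (Suc (2 * k) div 2))\<^sup>2"
      if k: "k \<in> {1..n}" for k
    proof -
      have "(A k)\<^sup>2 + (B k)\<^sup>2 = ((c (2 * k - 1))\<^sup>2 + (c (2 * k))\<^sup>2) * ((cos (\<gamma> k))\<^sup>2 + (sin (\<gamma> k))\<^sup>2) / (\<psi> k)\<^sup>2"
      proof -
        have "(x * u + y * v)\<^sup>2 + (y * u - x * v)\<^sup>2 = (y\<^sup>2 + x\<^sup>2) * (u\<^sup>2 + v\<^sup>2)" for x y u v :: real
          by (simp add: power2_eq_square algebra_simps)
        then show ?thesis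
          unfolding A_def B_def power_divide add_divide_distrib[symmetric] by simp
      qed
      then show ?thesis using k by (simp add: d_def power_divide add_divide_distrib)
    qed
    then show ?thesis unfolding sum_pairs by (intro sum.cong) auto
  qed
  also have "pi * \<dots> \<le> 1" using bound by (simp add: field_simps)
  finally have norm: "L2_norm_periodic \<phi> \<le> 1" by (simp add: L2_norm_periodic_def set_integral_circle)
  have "(LINT t|circle. trig i t) = 0" if "i \<ge> 1" for i
    using that trig_orthogonal_circle[of i 0] by (simp add: trig_def)
  then have mean: "(LINT t|circle. \<phi> t) = 0"
    unfolding \<phi> using integrable_circle_continuous[OF continuous_trig]
    by (simp add: Bochner_Integration.integral_sum)
  \<comment> \<open>\<open>2 * c 0\<close> because the class halves its additive constant.\<close>
  have conv: "f x = (2 * c 0) / 2 + 1 / pi * (LINT t|circle. \<phi> (x - t) * \<Psi> t)" for x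
  proof -
    have "1 / pi * (LINT t|circle. \<phi> (x - t) * \<Psi> t) =
      (\<Sum>k\<in>{1..n}. \<psi> k * (A k * cos (real k * x - \<gamma> k) + B k * sin (real k * x - \<gamma> k)))"
      using convolution_trig_polynomial[OF ker, where n = n and A = A and B = B and x = x] by (simp add: \<phi>_def \<gamma>_def)
    also have "\<dots> = (\<Sum>k\<in>{1..n}. c (2 * k - 1) * trig (2 * k - 1) x + c (2 * k) * trig (2 * k) x)"
    proof (rule sum.cong[OF refl])
      fix k assume k: "k \<in> {1..n}"
      have "\<psi> k * A k = c (2 * k) * cos (\<gamma> k) + c (2 * k - 1) * sin (\<gamma> k)"
        "\<psi> k * B k = c (2 * k - 1) * cos (\<gamma> k) - c (2 * k) * sin (\<gamma> k)"
        using pos[of k] k by (auto simp: A_def B_def)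
      moreover have "(cos (\<gamma> k))\<^sup>2 + (sin (\<gamma> k))\<^sup>2 = 1" by simp
      moreover have "trig (2 * k) x = cos (real k * x)" "trig (2 * k - 1) x = sin (real k * x)"
        using k by (auto simp: trig_def)
      moreover have "(p * u + q * v) * (C * u + S * v) + (q * u - p * v) * (S * u - C * v) = q * S + p * C"
        if "u\<^sup>2 + v\<^sup>2 = 1" for p q u v C S :: real
      proof -
        have "(p * u + q * v) * (C * u + S * v) + (q * u - p * v) * (S * u - C * v) = (q * S + p * C) * (u\<^sup>2 + v\<^sup>2)"
          by (simp add: power2_eq_square algebra_simps)
        then show ?thesis using that by simp
      qed
      ultimately show "\<psi> k * (A k * cos (real k * x - \<gamma> k) + B k * sin (real k * x - \<gamma> k)) =
          c (2 * k - 1) * trig (2 * k - 1) x + c (2 * k) * trig (2 * k) x"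
        unfolding cos_diff sin_diff distrib_left mult.assoc[symmetric] by simp
    qed
    also have "\<dots> = (\<Sum>i\<in>{1..2 * n}. c i * trig i x)" by (simp only: sum_pairs)
    also have "f x = c 0 + \<dots>"
      unfolding f atMost_atLeast0 by (simp add: sum.atLeast_Suc_atMost trig_def)
    finally show ?thesis by simp
  qed
  show ?thesis
    unfolding conv_class_def set_integral_circle mem_Collect_eq
    by (intro conjI exI[where x = \<Psi>] exI[where x = "2 * c 0"] exI[where x = \<phi>] allI
        per[OF f] ker L2 norm mean conv)
qed

context
  fixes \<psi> \<beta> :: "nat \<Rightarrow> real"
  assumes pos: "\<And>k. k \<ge> 1 \<Longrightarrow> 0 < \<psi> k" and summable: "summable (\<lambda>k. \<psi> (Suc k))"
begin

lemma harmonic_bound: "\<bar>\<psi> (Suc k) * cos y\<bar> \<le> \<psi> (Suc k)"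
  using pos[of "Suc k"] by (simp add: abs_mult mult_left_le)

lemma continuous_harmonic: "continuous_on UNIV (\<lambda>t. \<psi> (Suc k) * cos (real (Suc k) * t - \<beta> (Suc k) * pi / 2))"
  by (intro continuous_intros)

lemma continuous_kernel_series: "continuous_on UNIV (kernel_series \<psi> \<beta>)"
proof -
  have "uniform_limit UNIV (\<lambda>n t. \<Sum>k<n. \<psi> (Suc k) * cos (real (Suc k) * t - \<beta> (Suc k) * pi / 2))
      (\<lambda>t. \<Sum>k. \<psi> (Suc k) * cos (real (Suc k) * t - \<beta> (Suc k) * pi / 2)) sequentially"
    by (rule Weierstrass_m_test[OF _ summable]) (simp add: harmonic_bound del: of_nat_Suc)
  then show ?thesis
    unfolding kernel_series_def[abs_def]
    by (rule uniform_limit_theorem[rotated]) (auto intro!: always_eventually continuous_intros)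
qed

lemma periodic_kernel_series: "periodic_2pi (kernel_series \<psi> \<beta>)"
proof -
  have "cos (real (Suc k) * (t + 2 * pi) - y) = cos (real (Suc k) * t - y)" for k t y
  proof -
    have "real (Suc k) * (t + 2 * pi) - y = (real (Suc k) * t - y) + 2 * pi * real (Suc k)"
      by (simp add: algebra_simps)
    moreover have "cos (2 * pi * real (Suc k)) = 1"
      by (rule cos_integer_2pi[OF Ints_of_nat])
    moreover have "sin (2 * pi * real (Suc k)) = 0"
      by (rule sin_integer_2pi[OF Ints_of_nat])
    ultimately show ?thesis by (simp only: cos_add)
  qed
  then show ?thesis unfolding periodic_2pi_def kernel_series_def by simp
qed

lemma is_kernel_kernel_series: "is_kernel \<psi> \<beta> (kernel_series \<psi> \<beta>)"
proof -
  have "(LINT t|circle. kernel_series \<psi> \<beta> t * trig i t) = pi * kernel_coeff \<psi> \<beta> i" for i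
  proof -
    have sums: "(\<lambda>k. LINT t|circle. trig i t * (\<psi> (Suc k) * cos (real (Suc k) * t - \<beta> (Suc k) * pi / 2)))
       sums (LINT t|circle. trig i t * kernel_series \<psi> \<beta> t)"
      unfolding kernel_series_def
      by (rule integral_circle_mult_series[OF integrable_circle_continuous[OF continuous_trig]
            continuous_harmonic harmonic_bound summable])
    have tm: "(LINT t|circle. trig i t * (\<psi> (Suc k) * cos (real (Suc k) * t - \<beta> (Suc k) * pi / 2)))
      = (if k = (i - 1) div 2 then pi * kernel_coeff \<psi> \<beta> i else 0)" for k
    proof -
      define \<gamma> where "\<gamma> = \<beta> (Suc k) * pi / 2"
      have "trig i t * (\<psi> (Suc k) * cos (real (Suc k) * t - \<gamma>)) =
         \<psi> (Suc k) * cos \<gamma> * (trig i t * trig (2 * Suc k) t) + \<psi> (Suc k) * sin \<gamma> * (trig i t * trig (2 * k + 1) t)" for t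
        by (simp add: trig_def cos_diff algebra_simps)
      then have "(LINT t|circle. trig i t * (\<psi> (Suc k) * cos (real (Suc k) * t - \<gamma>))) =
         \<psi> (Suc k) * cos \<gamma> * (LINT t|circle. trig i t * trig (2 * Suc k) t)
         + \<psi> (Suc k) * sin \<gamma> * (LINT t|circle. trig i t * trig (2 * k + 1) t)"
        using integrable_circle_trig_mult by (simp del: mult_Suc_right)
      also have "\<dots> = (if k = (i - 1) div 2 then pi * kernel_coeff \<psi> \<beta> i else 0)"
      proof -
        consider "i = 0" | b where "i = 2 * Suc b" | b where "i = Suc (2 * b)"
          by (metis evenE not0_implies_Suc oddE Suc_eq_plus1 mult_0_right)
        then show ?thesis
        proof cases
          case 1
          then show ?thesis by (simp add: trig_orthogonal_circle kernel_coeff_def)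
        next
          case (2 b)
          have h: "i = 2 * Suc k \<longleftrightarrow> k = b" "i \<noteq> 2 * k + 1" "(i - 1) div 2 = b" "Suc i div 2 = Suc b" "i \<noteq> 0" "even i"
            using 2 by (simp_all, presburger+)
          show ?thesis using h by (simp add: trig_orthogonal_circle kernel_coeff_def Let_def \<gamma>_def)
        next
          case (3 b)
          have h: "i \<noteq> 2 * Suc k" "i = 2 * k + 1 \<longleftrightarrow> k = b" "(i - 1) div 2 = b" "Suc i div 2 = Suc b" "i \<noteq> 0" "odd i"
            using 3 by (simp_all, presburger+)
          show ?thesis using h by (simp add: trig_orthogonal_circle kernel_coeff_def Let_def \<gamma>_def)
        qed
      qed
      finally show ?thesis unfolding \<gamma>_def .
    qed
    have "(LINT t|circle. trig i t * kernel_series \<psi> \<beta> t) = pi * kernel_coeff \<psi> \<beta> i"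
      using sums unfolding tm by (rule sums_unique2) (rule sums_single)
    then show ?thesis by (simp add: mult.commute)
  qed
  then show ?thesis
    using L2_periodicI[OF periodic_kernel_series continuous_kernel_series] by (simp add: is_kernel_iff_trig)
qed

lemma kernel_unique:
  assumes "is_kernel \<psi> \<beta> \<Psi>"
  shows "AE t in circle. \<Psi> t = kernel_series \<psi> \<beta> t"
proof -
  let ?D = "\<lambda>t. \<Psi> t - kernel_series \<psi> \<beta> t"
  have L2: "\<Psi> \<in> L2_periodic" "kernel_series \<psi> \<beta> \<in> L2_periodic"
    and co: "(LINT t|circle. \<Psi> t * trig i t) = (LINT t|circle. kernel_series \<psi> \<beta> t * trig i t)" for i
    using assms is_kernel_kernel_series by (auto simp: is_kernel_iff_trig)
  have i: "integrable circle (\<lambda>t. f t * trig i t)" if "f \<in> L2_periodic" for f i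
    by (intro integrable_circle_mult_continuous L2_periodicD that continuous_intros)
  have "AE t in circle. ?D t = 0"
  proof (rule fourier_uniqueness)
    show "integrable circle ?D" using L2_periodicD(4) L2 by simp
    show "(LINT t|circle. ?D t * trig i t) = 0" for i
      using i[OF L2(1), of i] i[OF L2(2), of i] co[of i] by (simp add: left_diff_distrib)
  qed
  then show ?thesis by simp
qed

text \<open>By uniqueness the kernel may be replaced by its absolutely convergent series, which is integrated
term by term; \<open>A\<close> and \<open>B\<close> are the Fourier coefficients of the function \<open>\<phi>\<close> in the convolution, and
their bound is Bessel's inequality.\<close>

lemma conv_class_expansion:
  assumes f: "f \<in> conv_class \<psi> \<beta>"
  shows "\<exists>a A B. (\<forall>m. (\<Sum>k\<in>{1..m}. (A k)\<^sup>2 + (B k)\<^sup>2) \<le> 1 / pi) \<and>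
    (\<forall>x. (\<lambda>k. \<psi> (Suc k) * (A (Suc k) * cos (real (Suc k) * x - \<beta> (Suc k) * pi / 2)
           + B (Suc k) * sin (real (Suc k) * x - \<beta> (Suc k) * pi / 2))) sums (f x - a))"
proof -
  from f obtain \<Psi> a0 \<phi> where ker: "is_kernel \<psi> \<beta> \<Psi>" and L2: "\<phi> \<in> L2_periodic"
    and norm: "L2_norm_periodic \<phi> \<le> 1"
    and fx: "\<And>x. f x = a0 / 2 + 1 / pi * (LINT t|circle. \<phi> (x - t) * \<Psi> t)"
    unfolding conv_class_def set_integral_circle by blast
  note per = L2_periodicD(1)[OF L2] and int = L2_periodicD(4)[OF L2]
  have i: "integrable circle (\<lambda>t. \<phi> t * trig i t)" for i
    by (intro integrable_circle_mult_continuous int continuous_intros)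
  define A where "A k = (LINT t|circle. \<phi> t * trig (2 * k) t) / pi" for k
  define B where "B k = (LINT t|circle. \<phi> t * trig (2 * k - 1) t) / pi" for k
  have "(\<Sum>k\<in>{1..m}. (A k)\<^sup>2 + (B k)\<^sup>2) \<le> 1 / pi" for m
  proof -
    have "(\<Sum>i\<in>{1..2 * m}. ((LINT t|circle. \<phi> t * trig i t) / pi)\<^sup>2) \<le> (LINT t|circle. (\<phi> t)\<^sup>2) / pi"
      using i integrable_circle_trig_mult L2_periodicD(3)[OF L2]
      by (intro bessel_inequality) (auto simp: trig_orthogonal_circle)
    also have "\<dots> \<le> 1 / pi"
    proof -
      have "(LINT t|circle. (\<phi> t)\<^sup>2) \<le> 1"
        using norm by (simp add: L2_norm_periodic_def set_integral_circle)
      then show ?thesis by (simp add: divide_right_mono)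
    qed
    finally show ?thesis unfolding sum_pairs A_def B_def by (simp add: add.commute)
  qed
  moreover have "(\<lambda>k. \<psi> (Suc k) * (A (Suc k) * cos (real (Suc k) * x - \<beta> (Suc k) * pi / 2)
           + B (Suc k) * sin (real (Suc k) * x - \<beta> (Suc k) * pi / 2))) sums (f x - a0 / 2)" for x
  proof -
    have intx: "integrable circle (\<lambda>t. \<phi> (x - t))" by (rule integrable_circle_reflect[OF per int])
    have "(LINT t|circle. \<phi> (x - t) * \<Psi> t) = (LINT t|circle. \<phi> (x - t) * kernel_series \<psi> \<beta> t)"
    proof (rule integral_cong_AE)
      have "\<Psi> \<in> borel_measurable circle"
        using ker L2_periodicD(2) by (auto simp: is_kernel_def)
      then show "(\<lambda>t. \<phi> (x - t) * \<Psi> t) \<in> borel_measurable circle"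
        using intx by measurable
      show "(\<lambda>t. \<phi> (x - t) * kernel_series \<psi> \<beta> t) \<in> borel_measurable circle"
        using integrable_circle_mult_continuous[OF intx continuous_kernel_series] by measurable
      show "AE t in circle. \<phi> (x - t) * \<Psi> t = \<phi> (x - t) * kernel_series \<psi> \<beta> t"
        using kernel_unique[OF ker] by eventually_elim simp
    qed
    then have fx': "f x - a0 / 2 = (LINT t|circle. \<phi> (x - t) * kernel_series \<psi> \<beta> t) / pi"
      by (simp add: fx)
    have sums: "(\<lambda>k. LINT t|circle. \<phi> (x - t) * (\<psi> (Suc k) * cos (real (Suc k) * t - \<beta> (Suc k) * pi / 2)))
      sums (LINT t|circle. \<phi> (x - t) * kernel_series \<psi> \<beta> t)"
      unfolding kernel_series_def
      by (rule integral_circle_mult_series[OF intx continuous_harmonic harmonic_bound summable])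
    have tm: "(LINT t|circle. \<phi> (x - t) * (\<psi> (Suc k) * cos (real (Suc k) * t - \<beta> (Suc k) * pi / 2))) / pi
      = \<psi> (Suc k) * (A (Suc k) * cos (real (Suc k) * x - \<beta> (Suc k) * pi / 2)
           + B (Suc k) * sin (real (Suc k) * x - \<beta> (Suc k) * pi / 2))" for k
    proof -
      define \<gamma> where "\<gamma> = \<beta> (Suc k) * pi / 2"
      define G where "G s = \<psi> (Suc k) * cos (real (Suc k) * x - \<gamma>) * (\<phi> s * trig (2 * Suc k) s)
          + \<psi> (Suc k) * sin (real (Suc k) * x - \<gamma>) * (\<phi> s * trig (2 * Suc k - 1) s)" for s
      have G: "G (x - t) = \<phi> (x - t) * (\<psi> (Suc k) * cos (real (Suc k) * t - \<gamma>))" for t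
      proof -
        have "cos (real (Suc k) * t - \<gamma>) = cos ((real (Suc k) * x - \<gamma>) - real (Suc k) * (x - t))"
          by (simp add: algebra_simps)
        also have "\<dots> = cos (real (Suc k) * x - \<gamma>) * trig (2 * Suc k) (x - t)
            + sin (real (Suc k) * x - \<gamma>) * trig (2 * Suc k - 1) (x - t)"
          unfolding cos_diff[of "real (Suc k) * x - \<gamma>"] by (simp add: trig_def)
        finally show ?thesis by (simp add: G_def algebra_simps)
      qed
      have "periodic_2pi G"
        using per periodic_trig unfolding G_def periodic_2pi_def by simp
      moreover have "integrable circle G"
        unfolding G_def using i by (intro Bochner_Integration.integrable_add integrable_mult_right) auto
      ultimately have "(LINT t|circle. G (x - t)) = (LINT t|circle. G t)"
        by (rule integral_circle_reflect)
      also have "\<dots> = \<psi> (Suc k) * cos (real (Suc k) * x - \<gamma>) * (pi * A (Suc k))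
          + \<psi> (Suc k) * sin (real (Suc k) * x - \<gamma>) * (pi * B (Suc k))"
        unfolding G_def A_def B_def using i[of "2 * Suc k"] i[of "2 * Suc k - 1"] by simp
      finally show ?thesis
        unfolding G \<gamma>_def by (simp add: field_simps)
    qed
    show ?thesis
      using sums_divide[OF sums, of pi] unfolding tm fx' .
  qed
  ultimately show ?thesis
    by (intro exI[of _ "a0 / 2"] exI[of _ A] exI[of _ B] conjI allI)
qed

end

section \<open>Fourier projections on the space of continuous periodic functions\<close>

definition trig_fun :: "nat \<Rightarrow> real \<Rightarrow>\<^sub>C real" where
  "trig_fun i = Bcontfun (trig i)"

lemma apply_trig_fun [simp]: "apply_bcontfun (trig_fun i) = trig i"
  unfolding trig_fun_def
  by (rule Bcontfun_inverse) (auto intro!: bcontfun_normI[where b = 1] continuous_trig abs_trig_le_1)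

lemma apply_bcontfun_sum: "apply_bcontfun (\<Sum>i\<in>I. f i) x = (\<Sum>i\<in>I. apply_bcontfun (f i) x)"
  for f :: "'i \<Rightarrow> real \<Rightarrow>\<^sub>C real"
  by (induction I rule: infinite_finite_induct) auto

definition trig_coeff :: "nat \<Rightarrow> (real \<Rightarrow>\<^sub>C real) \<Rightarrow> real" where
  "trig_coeff i f = (LINT t|circle. apply_bcontfun f t * trig i t) / (if i = 0 then 2 * pi else pi)"

lemma bounded_linear_trig_coeff: "bounded_linear (trig_coeff i)"
proof -
  have i: "integrable circle (\<lambda>t. apply_bcontfun f t * trig i t)" for f :: "real \<Rightarrow>\<^sub>C real"
    by (intro integrable_circle_continuous continuous_intros) auto
  show ?thesis
  proof (rule bounded_linear_intro)
    show "trig_coeff i (f + g) = trig_coeff i f + trig_coeff i g" for f g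
      using i by (simp add: trig_coeff_def distrib_right add_divide_distrib)
    show "trig_coeff i (c *\<^sub>R f) = c *\<^sub>R trig_coeff i f" for c f
      by (simp add: trig_coeff_def mult.assoc)
    show "norm (trig_coeff i f) \<le> norm f * 2" for f
    proof -
      have "\<bar>LINT t|circle. apply_bcontfun f t * trig i t\<bar> \<le> (LINT t|circle. \<bar>apply_bcontfun f t * trig i t\<bar>)"
        using integral_norm_bound[of circle "\<lambda>t. apply_bcontfun f t * trig i t"] by simp
      also have "\<dots> \<le> (LINT t|circle. norm f)"
      proof (rule integral_mono)
        show "integrable circle (\<lambda>t. \<bar>apply_bcontfun f t * trig i t\<bar>)" using i by simp
        show "integrable circle (\<lambda>t. norm f)" by (intro integrable_circle_continuous continuous_intros)
        show "\<bar>apply_bcontfun f t * trig i t\<bar> \<le> norm f" for t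
          using mult_mono[OF norm_bounded[of f t] abs_trig_le_1[of i t]] by (simp add: abs_mult)
      qed
      also have "\<dots> = 2 * pi * norm f"
        using measure_circle by simp
      finally have *: "\<bar>LINT t|circle. apply_bcontfun f t * trig i t\<bar> \<le> 2 * pi * norm f" .
      have "norm (trig_coeff i f) \<le> \<bar>LINT t|circle. apply_bcontfun f t * trig i t\<bar> / pi"
        unfolding trig_coeff_def by (auto simp: field_simps)
      also have "\<dots> \<le> norm f * 2" using * by (simp add: field_simps)
      finally show ?thesis .
    qed
  qed
qed

lemma trig_coeff_trig_fun: "trig_coeff i (trig_fun l) = (if i = l then 1 else 0)"
  using trig_orthogonal_circle[of l i] by (auto simp: trig_coeff_def)

lemma subspace_C_periodic: "subspace C_periodic"
  by (auto simp: subspace_def C_periodic_def periodic_2pi_def)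

lemma span_trig_fun_subset: "span (trig_fun ` I) \<subseteq> C_periodic"
  by (intro span_minimal subspace_C_periodic) (auto simp: C_periodic_def periodic_trig)

lemma inj_trig_fun: "inj trig_fun"
proof (rule injI)
  fix i l assume "trig_fun i = trig_fun l"
  then have "trig_coeff i (trig_fun l) = 1" using trig_coeff_trig_fun[of i i] by simp
  then show "i = l" using trig_coeff_trig_fun[of i l] by (simp split: if_splits)
qed

lemma span_trig_fun_expand:
  assumes "finite I" "f \<in> span (trig_fun ` I)"
  shows "f = (\<Sum>i\<in>I. trig_coeff i f *\<^sub>R trig_fun i)"
  using assms(2)
proof (induction rule: span_induct_alt)
  case base
  interpret L: bounded_linear "trig_coeff i" for i by (rule bounded_linear_trig_coeff)
  show ?case by (simp add: L.zero)
next
  case (step c x y)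
  then obtain l where l: "l \<in> I" "x = trig_fun l" by auto
  interpret L: bounded_linear "trig_coeff i" for i by (rule bounded_linear_trig_coeff)
  have "(\<Sum>i\<in>I. trig_coeff i (c *\<^sub>R x + y) *\<^sub>R trig_fun i) =
     (\<Sum>i\<in>I. if i = l then c *\<^sub>R trig_fun l else 0) + (\<Sum>i\<in>I. trig_coeff i y *\<^sub>R trig_fun i)"
    unfolding sum.distrib[symmetric]
    by (intro sum.cong refl) (auto simp: L.add L.scaleR l trig_coeff_trig_fun scaleR_add_left)
  then show ?case using step.IH assms(1) l by simp
qed

lemma independent_trig_fun: "finite I \<Longrightarrow> independent (trig_fun ` I)"
proof (rule independent_if_scalars_zero)
  fix c x
  assume I: "finite I" and z: "(\<Sum>x\<in>trig_fun ` I. c x *\<^sub>R x) = 0" and x: "x \<in> trig_fun ` I"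
  interpret L: bounded_linear "trig_coeff i" for i by (rule bounded_linear_trig_coeff)
  obtain l where l: "l \<in> I" "x = trig_fun l" using x by auto
  have "0 = trig_coeff l (\<Sum>x\<in>trig_fun ` I. c x *\<^sub>R x)" by (simp add: z L.zero)
  also have "\<dots> = trig_coeff l (\<Sum>i\<in>I. c (trig_fun i) *\<^sub>R trig_fun i)"
    by (subst sum.reindex[OF inj_on_subset[OF inj_trig_fun subset_UNIV]]) simp
  also have "\<dots> = (\<Sum>i\<in>I. if l = i then c (trig_fun l) else 0)"
    by (auto simp: L.sum L.scaleR trig_coeff_trig_fun intro!: sum.cong)
  also have "\<dots> = c x" using l I by simp
  finally show "c x = 0" by simp
qed simp

lemma span_trig_fun_C_subspaces: "span (trig_fun ` {..<N}) \<in> C_subspaces N"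
  unfolding C_subspaces_def
  using span_trig_fun_subset[of "{..<N}"] independent_trig_fun[of "{..<N}"] card_image[OF inj_on_subset[OF inj_trig_fun subset_UNIV], of "{..<N}"]
  by (auto intro!: exI[of _ "trig_fun ` {..<N}"])

definition fourier_projection :: "nat \<Rightarrow> (real \<Rightarrow>\<^sub>C real) \<Rightarrow> (real \<Rightarrow>\<^sub>C real)" where
  "fourier_projection N f = (\<Sum>i<N. trig_coeff i f *\<^sub>R trig_fun i)"

lemma bounded_linear_fourier_projection: "bounded_linear (fourier_projection N)"
  unfolding fourier_projection_def[abs_def]
  by (intro bounded_linear_sum bounded_linear_scaleR_const bounded_linear_trig_coeff)

lemma fourier_projection_in_span: "fourier_projection N f \<in> span (trig_fun ` {..<N})"
  unfolding fourier_projection_def by (intro span_sum span_scale span_base) auto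

lemma fourier_projection_C_projections: "fourier_projection N \<in> C_projections (span (trig_fun ` {..<N}))"
proof -
  interpret P: bounded_linear "fourier_projection N" by (rule bounded_linear_fourier_projection)
  have "fourier_projection N f = f" if "f \<in> span (trig_fun ` {..<N})" for f
    using span_trig_fun_expand[OF _ that] by (simp add: fourier_projection_def)
  then show ?thesis
    using fourier_projection_in_span
    by (auto simp: C_projections_def C_linear_operators_def P.add P.scaleR)
qed

lemma fourier_projection_trig_fun: "fourier_projection N (trig_fun l) = (if l < N then trig_fun l else 0)"
proof -
  have "fourier_projection N (trig_fun l) = (\<Sum>i<N. if i = l then trig_fun l else 0)"
    unfolding fourier_projection_def by (intro sum.cong) (auto simp: trig_coeff_trig_fun)
  then show ?thesis by simp
qed

lemma norm_harmonic_le: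
  assumes "p\<^sup>2 + q\<^sup>2 \<le> \<rho>\<^sup>2" "0 \<le> \<rho>" "k \<ge> 1"
  shows "norm (p *\<^sub>R trig_fun (2 * k) + q *\<^sub>R trig_fun (2 * k - 1)) \<le> \<rho>"
proof (rule norm_bound)
  fix x
  have "(p * c + q * s)\<^sup>2 \<le> (p\<^sup>2 + q\<^sup>2) * (c\<^sup>2 + s\<^sup>2)" for c s :: real
  proof -
    have "(p\<^sup>2 + q\<^sup>2) * (c\<^sup>2 + s\<^sup>2) - (p * c + q * s)\<^sup>2 = (p * s - q * c)\<^sup>2"
      by (simp add: power2_eq_square algebra_simps)
    then show ?thesis by (metis diff_ge_0_iff_ge zero_le_power2)
  qed
  from this[of "cos (real k * x)" "sin (real k * x)"]
  have "(p * cos (real k * x) + q * sin (real k * x))\<^sup>2 \<le> \<rho>\<^sup>2" using assms(1) by simp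
  then have "\<bar>p * cos (real k * x) + q * sin (real k * x)\<bar> \<le> \<rho>" using assms(2) by (simp add: power2_le_iff_abs_le)
  then show "norm (apply_bcontfun (p *\<^sub>R trig_fun (2 * k) + q *\<^sub>R trig_fun (2 * k - 1)) x) \<le> \<rho>"
    using assms(3) by (simp add: trig_def)
qed

context
  fixes \<psi> \<beta> :: "nat \<Rightarrow> real"
  assumes pos: "\<And>k. k \<ge> 1 \<Longrightarrow> 0 < \<psi> k" and summable: "summable (\<lambda>k. \<psi> (Suc k))"
begin

lemma summable_square: "summable (\<lambda>k. (\<psi> (Suc n + k))\<^sup>2)"
proof -
  have s: "summable (\<lambda>k. \<psi> (Suc n + k))"
    using summable_ignore_initial_segment[OF summable, of n] by (simp add: add.commute)
  define S where "S = (\<Sum>k. \<psi> (Suc n + k))"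
  have le: "\<psi> (Suc n + k) \<le> S" for k
    using sum_le_suminf[OF s, of "{k}"] pos unfolding S_def by (simp add: less_imp_le)
  show ?thesis
  proof (rule summable_comparison_test'[OF summable_mult[OF s, of S], of 0])
    fix k
    have "\<psi> (Suc n + k) * \<psi> (Suc n + k) \<le> S * \<psi> (Suc n + k)"
      using le[of k] pos[of "Suc n + k"] by (intro mult_right_mono) auto
    then show "norm ((\<psi> (Suc n + k))\<^sup>2) \<le> S * \<psi> (Suc n + k)" by (simp add: power2_eq_square)
  qed
qed

text \<open>By the lower bound on \<open>N\<close> the remainder contains no harmonic of degree below \<open>n\<close>; from each other
harmonic the projection removes the cosine, the sine, both or nothing, which does not increase the
amplitude. The amplitudes \<open>\<psi> k * sqrt ((A k)\<^sup>2 + (B k)\<^sup>2)\<close> are summed by the Cauchy-Schwarz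
inequality. The argument runs through partial sums, which converge uniformly to \<open>f\<close>.\<close>

lemma norm_fourier_remainder_le:
  assumes f: "f \<in> C_conv_class \<psi> \<beta>" and n: "n \<ge> 1" and N: "2 * n - 1 \<le> N"
  shows "norm (f - fourier_projection N f) \<le> sqrt ((\<Sum>k. (\<psi> (n + k))\<^sup>2) / pi)"
proof -
  have fc: "apply_bcontfun f \<in> conv_class \<psi> \<beta>" using f by (simp add: C_conv_class_def)
  obtain a A B
    where AB: "\<forall>m. (\<Sum>k\<in>{1..m}. (A k)\<^sup>2 + (B k)\<^sup>2) \<le> 1 / pi"
    and sums: "\<forall>x. (\<lambda>k. \<psi> (Suc k) * (A (Suc k) * cos (real (Suc k) * x - \<beta> (Suc k) * pi / 2)
           + B (Suc k) * sin (real (Suc k) * x - \<beta> (Suc k) * pi / 2))) sums (apply_bcontfun f x - a)"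
    using conv_class_expansion[OF pos summable fc] by blast
  define \<gamma> where "\<gamma> k = \<beta> k * pi / 2" for k
  define \<rho> where "\<rho> k = \<psi> k * sqrt ((A k)\<^sup>2 + (B k)\<^sup>2)" for k
  define p where "p k = \<psi> k * (A k * cos (\<gamma> k) - B k * sin (\<gamma> k))" for k
  define q where "q k = \<psi> k * (A k * sin (\<gamma> k) + B k * cos (\<gamma> k))" for k
  define h where "h k = p k *\<^sub>R trig_fun (2 * k) + q k *\<^sub>R trig_fun (2 * k - 1)" for k
  have \<rho>0: "0 \<le> \<rho> k" if "k \<ge> 1" for k using pos[OF that] by (simp add: \<rho>_def)
  have pq: "(p k)\<^sup>2 + (q k)\<^sup>2 = (\<rho> k)\<^sup>2" for k
  proof -
    have "(w * (x * c - y * s))\<^sup>2 + (w * (x * s + y * c))\<^sup>2 = w\<^sup>2 * (x\<^sup>2 + y\<^sup>2) * (c\<^sup>2 + s\<^sup>2)"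
      for w x y c s :: real by (simp add: power2_eq_square algebra_simps)
    then show ?thesis by (simp add: p_def q_def \<rho>_def power_mult_distrib)
  qed
  have hx: "apply_bcontfun (h k) x = \<psi> k * (A k * cos (real k * x - \<beta> k * pi / 2) + B k * sin (real k * x - \<beta> k * pi / 2))"
    if "k \<ge> 1" for k x
    using that unfolding \<gamma>_def[symmetric]
    by (simp add: h_def p_def q_def trig_def cos_diff sin_diff algebra_simps)
  have hnorm: "norm (h k) \<le> \<rho> k" if "k \<ge> 1" for k
    unfolding h_def by (rule norm_harmonic_le) (use pq \<rho>0 that in auto)
  define s where "s m = a *\<^sub>R trig_fun 0 + (\<Sum>k\<in>{1..m}. h k)" for m
  interpret P: bounded_linear "fourier_projection N" by (rule bounded_linear_fourier_projection)
  have "s \<longlonglongrightarrow> f"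
  proof (rule uniform_limit_tendsto_bcontfun)
    have \<rho>le: "\<rho> (Suc k) \<le> \<psi> (Suc k) * sqrt (1 / pi)" for k
    proof -
      have "(A (Suc k))\<^sup>2 + (B (Suc k))\<^sup>2 \<le> (\<Sum>k\<in>{1..Suc k}. (A k)\<^sup>2 + (B k)\<^sup>2)"
        by (simp add: sum_nonneg)
      also have "\<dots> \<le> 1 / pi" by (rule AB[rule_format])
      finally show ?thesis unfolding \<rho>_def using pos[of "Suc k"]
        by (intro mult_left_mono real_sqrt_le_mono) auto
    qed
    have "uniform_limit UNIV (\<lambda>m x. \<Sum>k<m. apply_bcontfun (h (Suc k)) x) (\<lambda>x. \<Sum>k. apply_bcontfun (h (Suc k)) x) sequentially"
    proof (rule Weierstrass_m_test)
      show "summable (\<lambda>k. \<psi> (Suc k) * sqrt (1 / pi))" using summable by (rule summable_mult2)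
      show "norm (apply_bcontfun (h (Suc k)) x) \<le> \<psi> (Suc k) * sqrt (1 / pi)" for k x
        using norm_bounded[of "h (Suc k)" x] hnorm[of "Suc k"] \<rho>le[of k] by linarith
    qed
    moreover have "(\<Sum>k. apply_bcontfun (h (Suc k)) x) = apply_bcontfun f x - a" for x
      using sums[rule_format, of x] hx by (simp add: sums_iff)
    ultimately have "uniform_limit UNIV (\<lambda>m x. a + (\<Sum>k<m. apply_bcontfun (h (Suc k)) x))
        (\<lambda>x. a + (apply_bcontfun f x - a)) sequentially"
      by (intro uniform_limit_add uniform_limit_const) simp
    moreover have "apply_bcontfun (s m) = (\<lambda>x. a + (\<Sum>k<m. apply_bcontfun (h (Suc k)) x))" for m
      by (rule ext) (simp add: s_def apply_bcontfun_sum trig_def sum.atLeast1_atMost_eq)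
    ultimately show "uniform_limit UNIV (\<lambda>m. apply_bcontfun (s m)) (apply_bcontfun f) sequentially"
      by simp
  qed
  then have lim: "(\<lambda>m. norm (s m - fourier_projection N (s m))) \<longlonglongrightarrow> norm (f - fourier_projection N f)"
    by (intro tendsto_intros P.tendsto)
  show ?thesis
  proof (rule LIMSEQ_le_const2[OF lim], intro exI allI impI)
    fix m :: nat
    have rem: "norm (h k - fourier_projection N (h k)) \<le> (if k < n then 0 else \<rho> k)" if k: "k \<in> {1..m}" for k
    proof -
      define p' where "p' = (if 2 * k < N then 0 else p k)"
      define q' where "q' = (if 2 * k - 1 < N then 0 else q k)"
      have eq: "h k - fourier_projection N (h k) = p' *\<^sub>R trig_fun (2 * k) + q' *\<^sub>R trig_fun (2 * k - 1)"
        by (auto simp: h_def P.add P.scaleR fourier_projection_trig_fun p'_def q'_def)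
      show ?thesis
      proof (cases "k < n")
        case True
        then have "2 * k < N" "2 * k - 1 < N" using N by linarith+
        then show ?thesis using True by (simp add: eq p'_def q'_def)
      next
        case False
        have "p'\<^sup>2 + q'\<^sup>2 \<le> (\<rho> k)\<^sup>2"
          using pq[of k] by (auto simp: p'_def q'_def) (smt (verit) zero_le_power2)+
        then have "norm (h k - fourier_projection N (h k)) \<le> \<rho> k"
          unfolding eq using \<rho>0 k by (intro norm_harmonic_le) auto
        then show ?thesis using False by simp
      qed
    qed
    have "0 < N" using N n by linarith
    then have "s m - fourier_projection N (s m) = (\<Sum>k\<in>{1..m}. h k - fourier_projection N (h k))"
      by (simp add: s_def P.add P.sum P.scaleR fourier_projection_trig_fun sum_subtractf)
    then have "norm (s m - fourier_projection N (s m)) \<le> (\<Sum>k\<in>{1..m}. if k < n then 0 else \<rho> k)"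
      using sum_norm_le[of "{1..m}" "\<lambda>k. h k - fourier_projection N (h k)", OF rem] by simp
    also have "\<dots> = (\<Sum>k\<in>{n..m}. \<psi> k * sqrt ((A k)\<^sup>2 + (B k)\<^sup>2))"
      unfolding \<rho>_def using n by (intro sum.mono_neutral_cong_right) auto
    also have "\<dots> \<le> sqrt ((\<Sum>k\<in>{n..m}. (\<psi> k)\<^sup>2) * (\<Sum>k\<in>{n..m}. (sqrt ((A k)\<^sup>2 + (B k)\<^sup>2))\<^sup>2))"
      by (rule real_le_rsqrt) (rule Cauchy_Schwarz_ineq_sum)
    also have "\<dots> \<le> sqrt ((\<Sum>k. (\<psi> (n + k))\<^sup>2) * (1 / pi))"
    proof (intro real_sqrt_le_mono mult_mono)
      have "(\<Sum>k\<in>{n..m}. (\<psi> k)\<^sup>2) = (\<Sum>k\<in>{..<Suc m - n}. (\<psi> (n + k))\<^sup>2)"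
        by (rule sum.reindex_bij_witness[where i = "\<lambda>k. n + k" and j = "\<lambda>k. k - n"]) auto
      also have "\<dots> \<le> (\<Sum>k. (\<psi> (n + k))\<^sup>2)"
        using summable_square[of "n - 1"] n by (intro sum_le_suminf) auto
      finally show "(\<Sum>k\<in>{n..m}. (\<psi> k)\<^sup>2) \<le> (\<Sum>k. (\<psi> (n + k))\<^sup>2)" .
      show "0 \<le> (\<Sum>k. (\<psi> (n + k))\<^sup>2)" using summable_square[of "n - 1"] n by (intro suminf_nonneg) auto
      have "(\<Sum>k\<in>{n..m}. (sqrt ((A k)\<^sup>2 + (B k)\<^sup>2))\<^sup>2) \<le> (\<Sum>k\<in>{1..m}. (A k)\<^sup>2 + (B k)\<^sup>2)"
        using n by (simp, intro sum_mono2) auto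
      also have "\<dots> \<le> 1 / pi" by (rule AB[rule_format])
      finally show "(\<Sum>k\<in>{n..m}. (sqrt ((A k)\<^sup>2 + (B k)\<^sup>2))\<^sup>2) \<le> 1 / pi" .
    qed (auto intro: sum_nonneg)
    finally show "norm (s m - fourier_projection N (s m)) \<le> sqrt ((\<Sum>k. (\<psi> (n + k))\<^sup>2) / pi)" by simp
  qed
qed

end

section \<open>Upper bounds for the widths\<close>

lemma kolmogorov_le_linear_width:
  assumes "K \<subseteq> C_periodic"
  shows "kolmogorov_width N K \<le> linear_width N K"
  unfolding kolmogorov_width_def linear_width_def
proof (rule INF_mono')
  fix F
  show "(SUP f\<in>K. INF u\<in>F. ennreal (norm (f - u))) \<le> (INF A\<in>C_linear_operators F. SUP f\<in>K. ennreal (norm (f - A f)))"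
  proof (rule INF_greatest, rule SUP_mono)
    fix A f assume "A \<in> C_linear_operators F" "f \<in> K"
    then have "A f \<in> F" using assms by (auto simp: C_linear_operators_def)
    then show "\<exists>m\<in>K. (INF u\<in>F. ennreal (norm (f - u))) \<le> ennreal (norm (m - A m))"
      using \<open>f \<in> K\<close> by (intro bexI[of _ f] INF_lower)
  qed
qed

lemma linear_le_projection_width: "linear_width N K \<le> projection_width N K"
  unfolding linear_width_def projection_width_def
  by (intro INF_mono' INF_superset_mono) (auto simp: C_projections_def)

lemma projection_width_le:
  assumes "\<And>f. f \<in> K \<Longrightarrow> norm (f - fourier_projection N f) \<le> U"
  shows "projection_width N K \<le> ennreal U"
  unfolding projection_width_def
  by (rule INF_lower2[OF span_trig_fun_C_subspaces], rule INF_lower2[OF fourier_projection_C_projections])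
     (auto intro!: SUP_least ennreal_leI assms)

text \<open>The projection maps a space of dimension \<open>N + 1\<close> into one of dimension \<open>N\<close>, so it annihilates some
element of norm \<open>\<epsilon>\<close>. That element belongs to \<open>K\<close>, and \<open>\<epsilon>\<close> is its distance from its projection.\<close>

lemma bernstein_width_le:
  assumes "\<And>f. f \<in> K \<Longrightarrow> norm (f - fourier_projection N f) \<le> U"
  shows "bernstein_width N K \<le> ennreal U"
  unfolding bernstein_width_def
proof (intro SUP_least)
  fix F \<epsilon> assume F: "F \<in> C_subspaces (N + 1)" and "\<epsilon> \<in> {\<epsilon>. 0 < \<epsilon> \<and> cball 0 \<epsilon> \<inter> F \<subseteq> K}"
  then have \<epsilon>: "0 < \<epsilon>" "cball 0 \<epsilon> \<inter> F \<subseteq> K" by auto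
  interpret P: bounded_linear "fourier_projection N" by (rule bounded_linear_fourier_projection)
  obtain B where B: "finite B" "independent B" "card B = N + 1" "span B = F"
    using F by (auto simp: C_subspaces_def)
  have "\<not> inj_on (fourier_projection N) (span B)"
  proof
    assume inj: "inj_on (fourier_projection N) (span B)"
    have "independent (fourier_projection N ` B)"
      by (rule linear_independent_injective_image[OF P.linear B(2) inj])
    moreover have "fourier_projection N ` B \<subseteq> span (trig_fun ` {..<N})"
      using fourier_projection_in_span by auto
    ultimately have "card (fourier_projection N ` B) \<le> card (trig_fun ` {..<N})"
      using independent_span_bound[of "trig_fun ` {..<N}" "fourier_projection N ` B"] by blast
    also have "\<dots> \<le> N" using card_image_le[of "{..<N}" trig_fun] by simp
    also have "card (fourier_projection N ` B) = N + 1"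
      using B inj_on_subset[OF inj span_superset] by (simp add: card_image)
    finally show False by simp
  qed
  then obtain g where g: "g \<in> F" "g \<noteq> 0" "fourier_projection N g = 0"
    using linear_injective_on_subspace_0[OF P.linear subspace_span, of B] B by blast
  define f where "f = (\<epsilon> / norm g) *\<^sub>R g"
  have nf: "norm f = \<epsilon>" using g \<epsilon> by (simp add: f_def)
  have "f \<in> F" using g B by (auto simp: f_def intro: span_scale)
  then have "f \<in> K" using \<epsilon> nf by auto
  then have "norm (f - fourier_projection N f) \<le> U" by (rule assms)
  moreover have "fourier_projection N f = 0" by (simp add: f_def P.scaleR g)
  ultimately show "ennreal \<epsilon> \<le> ennreal U" using nf by (simp add: ennreal_leI)
qed

section \<open>Trigonometric polynomials on equidistant nodes\<close>

definition node :: "nat \<Rightarrow> real \<Rightarrow> nat \<Rightarrow> real" where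
  "node n \<theta> j = \<theta> + real j * pi / real n"

lemma sum_cis_node:
  fixes m :: int
  assumes n: "n \<ge> 1" and m: "m \<noteq> 0" "\<bar>m\<bar> < 2 * int n"
  shows "(\<Sum>j<2 * n. cis (of_int m * node n \<theta> j)) = 0"
proof -
  define r where "r = cis (of_int m * pi / real n)"
  have pow: "cis (of_int m * node n \<theta> j) = cis (of_int m * \<theta>) * r ^ j" for j
    unfolding r_def Complex.DeMoivre cis_mult node_def using n by (intro arg_cong[where f = cis]) (simp add: field_simps)
  have "r \<noteq> 1"
  proof
    assume "r = 1"
    then have "cos (of_int m * pi / real n) = 1" by (simp add: r_def complex_eq_iff)
    then obtain k :: int where "of_int m * pi / real n = of_int k * 2 * pi"
      using cos_one_2pi_int by blast
    then have "real_of_int m = real_of_int (2 * k * int n)" using n by (simp add: field_simps)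
    then have mk: "m = 2 * k * int n" by (simp only: of_int_eq_iff)
    then have "k \<noteq> 0" using m by auto
    then have "1 * (2 * int n) \<le> \<bar>k\<bar> * (2 * int n)" by (intro mult_right_mono) auto
    then show False using m mk by (simp add: abs_mult)
  qed
  have "r ^ (2 * n) = cis (2 * pi * of_int m)"
    unfolding r_def Complex.DeMoivre using n by (intro arg_cong[where f = cis]) (simp add: field_simps)
  then have "r ^ (2 * n) = 1" by simp
  then have "(\<Sum>j<2 * n. r ^ j) = 0"
    using \<open>r \<noteq> 1\<close> by (simp add: sum_gp_strict)
  then show ?thesis unfolding pow sum_distrib_left[symmetric] by simp
qed

lemma
  fixes m :: int
  assumes n: "n \<ge> 1"
  shows sum_cos_node: "m \<noteq> 0 \<Longrightarrow> \<bar>m\<bar> < 2 * int n \<Longrightarrow> (\<Sum>j<2 * n. cos (of_int m * node n \<theta> j)) = 0"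
    and sum_sin_node: "\<bar>m\<bar> < 2 * int n \<Longrightarrow> (\<Sum>j<2 * n. sin (of_int m * node n \<theta> j)) = 0"
proof -
  show "(\<Sum>j<2 * n. cos (of_int m * node n \<theta> j)) = 0" if "m \<noteq> 0" "\<bar>m\<bar> < 2 * int n"
    using arg_cong[OF sum_cis_node[OF n that, of \<theta>], of Re] by simp
  show "(\<Sum>j<2 * n. sin (of_int m * node n \<theta> j)) = 0" if "\<bar>m\<bar> < 2 * int n"
  proof (cases "m = 0")
    case False
    then show ?thesis using arg_cong[OF sum_cis_node[OF n False that, of \<theta>], of Im] by simp
  qed simp
qed

lemma trig_orthogonal_node:
  assumes n: "n \<ge> 1" and deg: "Suc i div 2 + Suc l div 2 < 2 * n"
  shows "(\<Sum>j<2 * n. trig i (node n \<theta> j) * trig l (node n \<theta> j)) =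
     (if i \<noteq> l then 0 else if i = 0 then 2 * real n else real n)"
proof -
  have "(LINT j|count_space {..<2 * n}. trig i (node n \<theta> j) * trig l (node n \<theta> j)) =
     (if i \<noteq> l then 0 else if i = 0 then measure (count_space {..<2 * n}) (space (count_space {..<2 * n}))
       else measure (count_space {..<2 * n}) (space (count_space {..<2 * n})) / 2)"
  proof (rule trig_orthogonal[where h = "2 * n - 1"])
    show "finite_measure (count_space {..<2 * n})" by (rule finite_measure_count_space) simp
  qed (use deg sum_cos_node[OF n] sum_sin_node[OF n] in \<open>auto simp: lebesgue_integral_count_space_finite\<close>)
  then show ?thesis by (simp add: lebesgue_integral_count_space_finite measure_count_space)
qed

text \<open>Bessel's inequality for the counting measure on the nodes. All values may have the full size \<open>\<epsilon>\<close>,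
which explains the factor \<open>2\<close>: the squared norm of a trigonometric function over the nodes is half
their number.\<close>

lemma discrete_bessel:
  assumes n: "n \<ge> 1" and v: "\<And>j. j < 2 * n \<Longrightarrow> \<bar>v j\<bar> \<le> \<epsilon>"
    and k: "k \<in> {1..<n}"
  shows "((\<Sum>j<2 * n. v j * trig (2 * k - 1) (node n \<theta> j)) / n)\<^sup>2 + ((\<Sum>j<2 * n. v j * trig (2 * k) (node n \<theta> j)) / n)\<^sup>2 \<le> 2 * \<epsilon>\<^sup>2"
proof -
  let ?M = "count_space {..<2 * n}"
  have "(\<Sum>i\<in>{2 * k - 1, 2 * k}. ((LINT j|?M. v j * trig i (node n \<theta> j)) / n)\<^sup>2) \<le> (LINT j|?M. (v j)\<^sup>2) / n"
  proof (rule bessel_inequality)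
    show "(LINT j|?M. trig i (node n \<theta> j) * trig l (node n \<theta> j)) = (if i = l then real n else 0)"
      if "i \<in> {2 * k - 1, 2 * k}" "l \<in> {2 * k - 1, 2 * k}" for i l
    proof -
      have "Suc i div 2 + Suc l div 2 < 2 * n" using that k by auto
      moreover have "i \<noteq> 0" using that k by auto
      ultimately show ?thesis
        using trig_orthogonal_node[OF n, of i l \<theta>] by (simp add: lebesgue_integral_count_space_finite)
    qed
  qed (use n in \<open>auto intro: integrable_count_space\<close>)
  moreover have "(\<Sum>j<2 * n. (v j)\<^sup>2) \<le> (\<Sum>j<2 * n. \<epsilon>\<^sup>2)"
    using v by (intro sum_mono) (metis abs_ge_zero lessThan_iff power2_abs power_mono)
  then have "(LINT j|?M. (v j)\<^sup>2) / n \<le> 2 * \<epsilon>\<^sup>2"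
    using n by (simp add: lebesgue_integral_count_space_finite field_simps)
  moreover have "2 * k - 1 \<noteq> 2 * k" using k by auto
  ultimately show ?thesis by (simp add: lebesgue_integral_count_space_finite)
qed

lemma trig_node_top:
  assumes "n \<ge> 1"
  shows "trig (2 * n) (node n \<theta> j) = (-1) ^ j * cos (real n * \<theta>)"
    and "trig (2 * n - 1) (node n \<theta> j) = (-1) ^ j * sin (real n * \<theta>)"
proof -
  have "real n * node n \<theta> j = real n * \<theta> + real j * pi" using assms by (simp add: node_def field_simps)
  then show "trig (2 * n) (node n \<theta> j) = (-1) ^ j * cos (real n * \<theta>)"
    "trig (2 * n - 1) (node n \<theta> j) = (-1) ^ j * sin (real n * \<theta>)"
    using assms by (auto simp: trig_def cos_add sin_add)
qed

text \<open>This is the sum of \<open>cos (k * m * pi / n)\<close> over the full period \<open>k < 2 * n\<close>, \<open>m = i - j\<close>, folded by the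
symmetry of \<open>k\<close> and \<open>2 * n - k\<close>.\<close>

lemma dirichlet_kernel_node:
  assumes n: "n \<ge> 1" and ij: "i < 2 * n" "j < 2 * n"
  shows "1 + 2 * (\<Sum>k\<in>{1..<n}. cos (real k * (node n \<theta> i - node n \<theta> j))) + cos (real n * (node n \<theta> i - node n \<theta> j))
     = (if i = j then 2 * real n else 0)"
proof (cases "i = j")
  case True
  then show ?thesis using n by simp
next
  case False
  define m where "m = int i - int j"
  define g where "g k = cos (of_int m * node n 0 k)" for k
  have m: "m \<noteq> 0" "\<bar>m\<bar> < 2 * int n" using False ij by (auto simp: m_def)
  have g: "g k = cos (real k * (node n \<theta> i - node n \<theta> j))" for k
    unfolding g_def using n by (intro arg_cong[where f = cos]) (simp add: node_def m_def field_simps)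
  have mirror: "g (2 * n - k) = g k" if "k \<le> 2 * n" for k
  proof -
    have "of_int m * node n 0 (2 * n - k) = 2 * pi * of_int m - of_int m * node n 0 k"
      using n that by (simp add: node_def of_nat_diff field_simps)
    then have "g (2 * n - k) = cos (2 * pi * of_int m - of_int m * node n 0 k)" unfolding g_def by simp
    then show ?thesis by (simp add: cos_diff g_def)
  qed
  have "0 = (\<Sum>k<2 * n. g k)" unfolding g_def using sum_cos_node[OF n m] by simp
  also have "{..<2 * n} = {0} \<union> {1..<n} \<union> {n} \<union> {n<..<2 * n}" using n by auto
  also have "(\<Sum>k\<in>{0} \<union> {1..<n} \<union> {n} \<union> {n<..<2 * n}. g k) = g 0 + (\<Sum>k\<in>{1..<n}. g k) + g n + (\<Sum>k\<in>{n<..<2 * n}. g k)"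
    using n by (subst sum.union_disjoint; (subst sum.union_disjoint)?; auto)
  also have "(\<Sum>k\<in>{n<..<2 * n}. g k) = (\<Sum>k\<in>{1..<n}. g k)"
    by (rule sum.reindex_bij_witness[where i = "\<lambda>k. 2 * n - k" and j = "\<lambda>k. 2 * n - k"]) (auto simp: mirror)
  also have "g 0 = 1" by (simp add: g)
  finally show ?thesis using False by (simp add: g)
qed

lemma trig_pair_product:
  assumes "k \<ge> 1"
  shows "trig (2 * k - 1) x * trig (2 * k - 1) y + trig (2 * k) x * trig (2 * k) y = cos (real k * (x - y))"
  using assms by (simp add: trig_def cos_diff right_diff_distrib)

lemma sum_trig_pairs:
  fixes F :: "nat \<Rightarrow> real"
  assumes n: "n \<ge> 1"
  shows "(\<Sum>i\<le>2 * n. F i) = F 0 + (\<Sum>k\<in>{1..<n}. F (2 * k - 1) + F (2 * k)) + (F (2 * n - 1) + F (2 * n))"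
proof -
  have "(\<Sum>i\<le>2 * n. F i) = F 0 + (\<Sum>i\<in>{1..2 * n}. F i)"
    unfolding atMost_atLeast0 by (simp add: sum.atLeast_Suc_atMost)
  also have "(\<Sum>i\<in>{1..2 * n}. F i) = (\<Sum>k\<in>{1..n}. F (2 * k - 1) + F (2 * k))" by (rule sum_pairs)
  also have "{1..n} = insert n {1..<n}" using n by auto
  finally show ?thesis by simp
qed

text \<open>The interpolant is the discrete convolution of the values with the kernel of \<open>dirichlet_kernel_node\<close>.
At the nodes the functions of degree \<open>n\<close> are multiples of \<open>(-1) ^ j\<close>, so the top harmonic has the
alternating average of the values as amplitude; it carries the factor \<open>1 / (2 * n)\<close> in place of
\<open>1 / n\<close>.\<close>

lemma trig_interpolation:
  assumes n: "n \<ge> 1" and v: "\<And>j. j < 2 * n \<Longrightarrow> \<bar>v j\<bar> \<le> \<epsilon>"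
  shows "\<exists>c. (\<forall>j<2 * n. (\<Sum>i\<le>2 * n. c i * trig i (node n \<theta> j)) = v j) \<and>
    (\<forall>k\<in>{1..<n}. (c (2 * k - 1))\<^sup>2 + (c (2 * k))\<^sup>2 \<le> 2 * \<epsilon>\<^sup>2) \<and>
    (c (2 * n - 1))\<^sup>2 + (c (2 * n))\<^sup>2 \<le> \<epsilon>\<^sup>2"
proof -
  define S where "S i = (\<Sum>j<2 * n. v j * trig i (node n \<theta> j))" for i
  define c where "c i = (if i \<in> {1..<2 * n - 1} then S i / n else S i / (2 * n))" for i
  have low: "c (2 * k - 1) = S (2 * k - 1) / n" "c (2 * k) = S (2 * k) / n" if "k \<in> {1..<n}" for k
    using that by (auto simp: c_def)
  have top: "c (2 * n - 1) = S (2 * n - 1) / (2 * n)" "c (2 * n) = S (2 * n) / (2 * n)" and c0: "c 0 = S 0 / (2 * n)"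
    using n by (auto simp: c_def)
  show ?thesis
  proof (intro exI[of _ c] conjI allI ballI impI)
    show "(c (2 * k - 1))\<^sup>2 + (c (2 * k))\<^sup>2 \<le> 2 * \<epsilon>\<^sup>2" if "k \<in> {1..<n}" for k
      unfolding low[OF that] S_def by (rule discrete_bessel[OF n v that])
    define w where "w = (\<Sum>j<2 * n. v j * (-1) ^ j) / (2 * n)"
    have cw: "c (2 * n) = w * cos (real n * \<theta>)" "c (2 * n - 1) = w * sin (real n * \<theta>)"
      unfolding top S_def trig_node_top[OF n] w_def by (simp_all add: sum_distrib_right mult.assoc)
    have "\<bar>\<Sum>j<2 * n. v j * (-1) ^ j\<bar> \<le> (\<Sum>j<2 * n. \<bar>v j * (-1) ^ j\<bar>)" by (rule sum_abs)
    also have "\<dots> \<le> (\<Sum>j<2 * n. \<epsilon>)" using v by (intro sum_mono) (simp add: abs_mult)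
    finally have "\<bar>w\<bar> \<le> \<epsilon>" unfolding w_def using n by (simp add: field_simps)
    then have "w\<^sup>2 \<le> \<epsilon>\<^sup>2" by (metis abs_ge_zero power2_abs power_mono)
    moreover have "(w * s)\<^sup>2 + (w * u)\<^sup>2 = w\<^sup>2 * (s\<^sup>2 + u\<^sup>2)" for s u
      by (simp add: power2_eq_square algebra_simps)
    ultimately show "(c (2 * n - 1))\<^sup>2 + (c (2 * n))\<^sup>2 \<le> \<epsilon>\<^sup>2" unfolding cw by simp
    fix j0 assume j0: "j0 < 2 * n"
    let ?x = "node n \<theta>"
    have "(\<Sum>i\<le>2 * n. c i * trig i (?x j0)) = S 0 / (2 * n)
        + (\<Sum>k\<in>{1..<n}. (S (2 * k - 1) * trig (2 * k - 1) (?x j0) + S (2 * k) * trig (2 * k) (?x j0)) / n)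
        + (S (2 * n - 1) * trig (2 * n - 1) (?x j0) + S (2 * n) * trig (2 * n) (?x j0)) / (2 * n)"
      unfolding sum_trig_pairs[OF n] top using low by (simp add: c0 trig_def add_divide_distrib)
    also have "\<dots> = (\<Sum>j<2 * n. v j) / (2 * n)
        + (\<Sum>k\<in>{1..<n}. (\<Sum>j<2 * n. v j * cos (real k * (?x j0 - ?x j))) / n)
        + (\<Sum>j<2 * n. v j * cos (real n * (?x j0 - ?x j))) / (2 * n)"
    proof -
      have "S (2 * k - 1) * trig (2 * k - 1) (?x j0) + S (2 * k) * trig (2 * k) (?x j0) =
         (\<Sum>j<2 * n. v j * cos (real k * (?x j0 - ?x j)))" if "k \<ge> 1" for k
        unfolding S_def sum_distrib_right sum.distrib[symmetric]
        by (intro sum.cong refl) (simp only: trig_pair_product[OF that, symmetric], simp add: algebra_simps)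
      then show ?thesis using n by (simp add: S_def trig_def)
    qed
    also have "\<dots> = (\<Sum>j<2 * n. v j * (1 + 2 * (\<Sum>k\<in>{1..<n}. cos (real k * (?x j0 - ?x j))) + cos (real n * (?x j0 - ?x j))) / (2 * n))"
    proof -
      have "(\<Sum>k\<in>{1..<n}. (\<Sum>j<2 * n. v j * cos (real k * (?x j0 - ?x j))) / n) =
        (\<Sum>j<2 * n. v j * (2 * (\<Sum>k\<in>{1..<n}. cos (real k * (?x j0 - ?x j)))) / (2 * n))"
        unfolding sum_divide_distrib by (subst sum.swap) (simp add: sum_distrib_left sum_divide_distrib)
      then show ?thesis
        by (simp add: distrib_left add_divide_distrib sum.distrib sum_divide_distrib)
    qed
    also have "\<dots> = (\<Sum>j<2 * n. if j = j0 then v j0 else 0)"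
    proof (intro sum.cong refl)
      fix j assume "j \<in> {..<2 * n}"
      then have "j < 2 * n" by simp
      from dirichlet_kernel_node[OF n j0 this, of \<theta>]
      show "v j * (1 + 2 * (\<Sum>k\<in>{1..<n}. cos (real k * (?x j0 - ?x j))) + cos (real n * (?x j0 - ?x j))) / (2 * n)
          = (if j = j0 then v j0 else 0)"
        using n by (simp only: split: if_split) auto
    qed
    also have "\<dots> = v j0" using j0 by simp
    finally show "(\<Sum>i\<le>2 * n. c i * trig i (?x j0)) = v j0" .
  qed
qed

text \<open>The lower coefficients are recovered from the values at the nodes by orthogonality. For the top
harmonic the nodes are placed at its extrema, where it alternates between the amplitude \<open>A\<close> and \<open>-A\<close>
while every lower harmonic has alternating average zero; so \<open>A\<close> is an average of numbers
of modulus at most \<open>\<epsilon>\<close>.\<close>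

lemma trig_polynomial_coeff_bounds:
  assumes n: "n \<ge> 1" and bound: "\<And>x. \<bar>\<Sum>i\<le>2 * n. c i * trig i x\<bar> \<le> \<epsilon>"
  shows "k \<in> {1..<n} \<Longrightarrow> (c (2 * k - 1))\<^sup>2 + (c (2 * k))\<^sup>2 \<le> 2 * \<epsilon>\<^sup>2"
    and "(c (2 * n - 1))\<^sup>2 + (c (2 * n))\<^sup>2 \<le> \<epsilon>\<^sup>2"
proof -
  define g where "g x = (\<Sum>i\<le>2 * n. c i * trig i x)" for x
  have coeff: "(\<Sum>j<2 * n. g (node n \<theta> j) * trig l (node n \<theta> j)) = (if l = 0 then 2 * real n else real n) * c l"
    if l: "l < 2 * n - 1" for \<theta> l
  proof -
    have "(\<Sum>j<2 * n. g (node n \<theta> j) * trig l (node n \<theta> j)) =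
      (\<Sum>i\<le>2 * n. c i * (\<Sum>j<2 * n. trig i (node n \<theta> j) * trig l (node n \<theta> j)))"
      unfolding g_def sum_distrib_right sum_distrib_left by (subst sum.swap) (simp add: mult.assoc)
    also have "\<dots> = (\<Sum>i\<le>2 * n. if i = l then (if l = 0 then 2 * real n else real n) * c l else 0)"
    proof (intro sum.cong refl)
      fix i assume "i \<in> {..2 * n}"
      then have "i \<le> 2 * n" by simp
      then have "Suc i div 2 + Suc l div 2 < 2 * n" using l by presburger
      then show "c i * (\<Sum>j<2 * n. trig i (node n \<theta> j) * trig l (node n \<theta> j)) =
          (if i = l then (if l = 0 then 2 * real n else real n) * c l else 0)"
        by (simp add: trig_orthogonal_node[OF n])
    qed
    also have "\<dots> = (if l = 0 then 2 * real n else real n) * c l" using l by simp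
    finally show ?thesis .
  qed
  show "(c (2 * k - 1))\<^sup>2 + (c (2 * k))\<^sup>2 \<le> 2 * \<epsilon>\<^sup>2" if k: "k \<in> {1..<n}"
  proof -
    have "(\<Sum>j<2 * n. g (node n 0 j) * trig i (node n 0 j)) / n = c i" if "i \<in> {2 * k - 1, 2 * k}" for i
    proof -
      have "i < 2 * n - 1" "i \<noteq> 0" using that k by auto
      then show ?thesis using coeff[of i 0] n by simp
    qed
    then show ?thesis using discrete_bessel[OF n _ k, of "\<lambda>j. g (node n 0 j)" \<epsilon> 0] bound by (simp add: g_def)
  qed
  define A where "A = sqrt ((c (2 * n - 1))\<^sup>2 + (c (2 * n))\<^sup>2)"
  have \<epsilon>0: "0 \<le> \<epsilon>" using bound[of 0] by linarith
  obtain \<theta> where \<theta>: "c (2 * n) = A * cos (real n * \<theta>)" "c (2 * n - 1) = A * sin (real n * \<theta>)"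
  proof (cases "A = 0")
    case True
    then have "c (2 * n) = 0" "c (2 * n - 1) = 0" by (auto simp: A_def)
    then show ?thesis using that[of 0] True by simp
  next
    case False
    have A2: "A\<^sup>2 = (c (2 * n))\<^sup>2 + (c (2 * n - 1))\<^sup>2"
      unfolding A_def by (subst real_sqrt_pow2) auto
    have "(c (2 * n) / A)\<^sup>2 + (c (2 * n - 1) / A)\<^sup>2 = 1"
      unfolding power_divide add_divide_distrib[symmetric] A2[symmetric] using False by simp
    then obtain t where "c (2 * n) / A = cos t" "c (2 * n - 1) / A = sin t"
      using sincos_total_2pi by metis
    then show ?thesis using that[of "t / n"] False n by (simp add: field_simps)
  qed
  \<comment> \<open>At the nodes, alternating signs are the values of the harmonic \<open>cos (n * (x - \<theta>))\<close>.\<close>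
  have alt: "(-1) ^ j = cos (real n * \<theta>) * trig (2 * n) (node n \<theta> j) + sin (real n * \<theta>) * trig (2 * n - 1) (node n \<theta> j)" for j
  proof -
    have "C * (z * C) + S * (z * S) = z * (C\<^sup>2 + S\<^sup>2)" for z C S :: real
      by (simp add: power2_eq_square algebra_simps)
    then have "z = C * (z * C) + S * (z * S)" if "C\<^sup>2 + S\<^sup>2 = 1" for z C S :: real using that by simp
    then show ?thesis unfolding trig_node_top[OF n] by (simp add: add.commute)
  qed
  have "(\<Sum>j<2 * n. g (node n \<theta> j) * (-1) ^ j) = (\<Sum>i\<le>2 * n. c i * (\<Sum>j<2 * n. trig i (node n \<theta> j) * (-1) ^ j))"
    unfolding g_def sum_distrib_right sum_distrib_left by (subst sum.swap) (simp add: mult.assoc)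
  also have "\<dots> = (\<Sum>i\<in>{2 * n - 1, 2 * n}. c i * (\<Sum>j<2 * n. trig i (node n \<theta> j) * (-1) ^ j))"
  proof (rule sum.mono_neutral_right)
    show "\<forall>i\<in>{..2 * n} - {2 * n - 1, 2 * n}. c i * (\<Sum>j<2 * n. trig i (node n \<theta> j) * (-1) ^ j) = 0"
    proof
      fix i assume "i \<in> {..2 * n} - {2 * n - 1, 2 * n}"
      then have i: "i < 2 * n - 1" by auto
      then have d: "Suc i div 2 + Suc (2 * n) div 2 < 2 * n" "Suc i div 2 + Suc (2 * n - 1) div 2 < 2 * n" "i \<noteq> 2 * n" "i \<noteq> 2 * n - 1"
        by presburger+
      have "(\<Sum>j<2 * n. trig i (node n \<theta> j) * (-1) ^ j) =
        cos (real n * \<theta>) * (\<Sum>j<2 * n. trig i (node n \<theta> j) * trig (2 * n) (node n \<theta> j))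
        + sin (real n * \<theta>) * (\<Sum>j<2 * n. trig i (node n \<theta> j) * trig (2 * n - 1) (node n \<theta> j))"
        unfolding alt sum_distrib_left sum.distrib[symmetric] by (intro sum.cong refl) (simp add: algebra_simps)
      also have "\<dots> = 0" using trig_orthogonal_node[OF n d(1)] trig_orthogonal_node[OF n d(2)] d by simp
      finally show "c i * (\<Sum>j<2 * n. trig i (node n \<theta> j) * (-1) ^ j) = 0" by simp
    qed
  qed auto
  also have "\<dots> = A * (2 * n)"
  proof -
    have sq: "(-1) ^ j * z * (-1) ^ j = (z :: real)" for j z
      by (simp add: power_add[symmetric] mult.commute mult.left_commute)
    have tops: "(\<Sum>j<2 * n. trig (2 * n) (node n \<theta> j) * (-1) ^ j) = 2 * n * cos (real n * \<theta>)"
      "(\<Sum>j<2 * n. trig (2 * n - 1) (node n \<theta> j) * (-1) ^ j) = 2 * n * sin (real n * \<theta>)"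
      unfolding trig_node_top[OF n] sq by simp_all
    have pythagoras: "A * S * (w * S) + A * C * (w * C) = A * w" if "C\<^sup>2 + S\<^sup>2 = 1" for C S w :: real
    proof -
      have "A * S * (w * S) + A * C * (w * C) = A * w * (C\<^sup>2 + S\<^sup>2)"
        by (simp add: power2_eq_square algebra_simps)
      then show ?thesis using that by simp
    qed
    have pair: "(\<Sum>i\<in>{a, b}. F i) = F a + F b" if "a \<noteq> b" for F :: "nat \<Rightarrow> real" and a b
      using that by simp
    have "2 * n - 1 \<noteq> 2 * n" using n by auto
    show ?thesis
      unfolding pair[OF \<open>2 * n - 1 \<noteq> 2 * n\<close>] tops \<theta> using pythagoras[of "cos (real n * \<theta>)" "sin (real n * \<theta>)" "real (2 * n)"] by simp
  qed
  finally have "(\<Sum>j<2 * n. g (node n \<theta> j) * (-1) ^ j) = A * (2 * n)" .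
  then have "A * (2 * n) \<le> \<bar>\<Sum>j<2 * n. g (node n \<theta> j) * (-1) ^ j\<bar>" by linarith
  also have "\<dots> \<le> (\<Sum>j<2 * n. \<bar>g (node n \<theta> j) * (-1) ^ j\<bar>)" by (rule sum_abs)
  also have "\<dots> = (\<Sum>j<2 * n. \<bar>g (node n \<theta> j)\<bar>)" by (simp add: abs_mult)
  also have "\<dots> \<le> (\<Sum>j<2 * n. \<epsilon>)" using bound by (intro sum_mono) (simp add: g_def)
  finally have "A \<le> \<epsilon>" using n by simp
  then have "A\<^sup>2 \<le> \<epsilon>\<^sup>2" by (intro power_mono) (simp_all add: A_def)
  then show "(c (2 * n - 1))\<^sup>2 + (c (2 * n))\<^sup>2 \<le> \<epsilon>\<^sup>2" by (simp add: A_def)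
qed

section \<open>Functionals on the nodes that annihilate a subspace\<close>

definition cyclic_shift :: "nat \<Rightarrow> nat \<Rightarrow> nat" where
  "cyclic_shift m j = (if j < m then Suc j else if j = m then 0 else j)"

lemma cyclic_shift_Suc: "cyclic_shift (Suc m) = Transposition.transpose 0 (Suc m) \<circ> cyclic_shift m"
  by (rule ext) (auto simp: cyclic_shift_def Transposition.transpose_def)

lemma cyclic_shift_permutes: "cyclic_shift m permutes {0..<Suc m}"
proof (induction m)
  case 0
  have "cyclic_shift 0 = id" by (rule ext) (simp add: cyclic_shift_def)
  then show ?case by (simp only: permutes_id)
next
  case (Suc m)
  have "cyclic_shift m permutes {0..<Suc (Suc m)}"
    by (rule permutes_subset[OF Suc]) auto
  moreover have "Transposition.transpose 0 (Suc m) permutes {0..<Suc (Suc m)}"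
    by (rule permutes_swap_id) auto
  ultimately show ?case unfolding cyclic_shift_Suc by (rule permutes_compose)
qed

lemma sign_cyclic_shift: "sign (cyclic_shift m) = (-1) ^ m"
proof (induction m)
  case 0
  have "cyclic_shift 0 = id" by (rule ext) (simp add: cyclic_shift_def)
  then show ?case by simp
next
  case (Suc m)
  have "permutation (cyclic_shift m)"
    using cyclic_shift_permutes permutation_permutes by blast
  then show ?case
    unfolding cyclic_shift_Suc
    by (subst sign_compose) (simp_all add: permutation_swap_id sign_swap_id Suc del: comp_apply)
qed

text \<open>As \<open>\<theta>\<close> runs from \<open>0\<close> to \<open>pi / n\<close>, the nodes move by one step. By periodicity the rows of the matrix
of values are then permuted by a cycle of even length \<open>2 * n\<close>, an odd permutation, so the
determinant changes its sign and has a zero in between. Functions that are too few to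
fill the square matrix may be completed by zeros.\<close>

lemma exists_node_annihilator:
  fixes b :: "nat \<Rightarrow> real \<Rightarrow> real"
  assumes n: "n \<ge> 1"
    and cont: "\<And>i. i < 2 * n \<Longrightarrow> continuous_on UNIV (b i)"
    and per: "\<And>i. i < 2 * n \<Longrightarrow> periodic_2pi (b i)"
  shows "\<exists>\<theta> c. (\<exists>j<2 * n. c j \<noteq> 0) \<and> (\<forall>i<2 * n. (\<Sum>j<2 * n. c j * b i (node n \<theta> j)) = 0)"
proof -
  define R where "R \<theta> = mat (2 * n) (2 * n) (\<lambda>(j, i). b i (node n \<theta> j))" for \<theta>
  have R: "R \<theta> \<in> carrier_mat (2 * n) (2 * n)" for \<theta> by (simp add: R_def)
  have detR: "Determinant.det (R \<theta>) = (\<Sum>p\<in>{p. p permutes {0..<2 * n}}. signof p * (\<Prod>i = 0..<2 * n. b (p i) (node n \<theta> i)))" for \<theta>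
    unfolding det_def'[OF R]
  proof (intro sum.cong refl)
    fix p assume "p \<in> {p. p permutes {0..<2 * n}}"
    then have "p i < 2 * n" if "i < 2 * n" for i using that permutes_in_image[of p "{0..<2 * n}" i] by simp
    then have "(\<Prod>i = 0..<2 * n. R \<theta> $$ (i, p i)) = (\<Prod>i = 0..<2 * n. b (p i) (node n \<theta> i))"
      by (intro prod.cong) (auto simp: R_def)
    then show "signof p * (\<Prod>i = 0..<2 * n. R \<theta> $$ (i, p i)) = signof p * (\<Prod>i = 0..<2 * n. b (p i) (node n \<theta> i))"
      by simp
  qed
  have "continuous_on UNIV (\<lambda>\<theta>. Determinant.det (R \<theta>))"
    unfolding detR
  proof (intro continuous_intros)
    fix p i assume "p \<in> {p. p permutes {0..<2 * n}}" "i \<in> {0..<2 * n}"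
    then have "p i < 2 * n" using permutes_in_image[of p "{0..<2 * n}" i] by simp
    then show "continuous_on UNIV (\<lambda>\<theta>. b (p i) (node n \<theta> i))"
      by (intro continuous_on_compose2[OF cont]) (auto simp: node_def intro!: continuous_intros)
  qed
  then have c: "continuous_on {0..pi / n} (\<lambda>\<theta>. Determinant.det (R \<theta>))"
    by (rule continuous_on_subset) simp
  have shift: "Determinant.det (R (pi / n)) = - Determinant.det (R 0)"
  proof -
    define s where "s = cyclic_shift (2 * n - 1)"
    have s: "s permutes {0..<2 * n}" using cyclic_shift_permutes[of "2 * n - 1"] n by (simp add: s_def)
    have sl: "s j < 2 * n" if "j < 2 * n" for j using that permutes_in_image[OF s, of j] by simp
    have "b i (node n (pi / n) j) = b i (node n 0 (s j))" if ij: "i < 2 * n" "j < 2 * n" for i j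
    proof (cases "j = 2 * n - 1")
      case True
      then have "node n (pi / n) j = node n 0 (s j) + 2 * pi"
        using n by (simp add: node_def s_def cyclic_shift_def of_nat_diff field_simps)
      then show ?thesis using per[OF ij(1)] by (simp add: periodic_2pi_def)
    next
      case False
      then have "node n (pi / n) j = node n 0 (s j)"
        using n ij by (simp add: node_def s_def cyclic_shift_def field_simps)
      then show ?thesis by simp
    qed
    then have "R (pi / n) = mat (2 * n) (2 * n) (\<lambda>(j, i). R 0 $$ (s j, i))"
      using sl by (intro eq_matI) (auto simp: R_def)
    then have "Determinant.det (R (pi / n)) = signof s * Determinant.det (R 0)"
      using det_permute_rows[OF R s] by simp
    moreover have "signof s = (-1 :: real)"
    proof -
      have "odd (2 * n - 1)" using n by simp
      then show ?thesis by (simp add: s_def sign_cyclic_shift)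
    qed
    ultimately show ?thesis by simp
  qed
  have "\<exists>\<theta>. Determinant.det (R \<theta>) = 0"
  proof (cases "Determinant.det (R 0) \<le> 0")
    case True
    then show ?thesis using IVT'[of "\<lambda>\<theta>. Determinant.det (R \<theta>)" 0 0 "pi / n", OF _ _ _ c] shift by auto
  next
    case False
    then show ?thesis using IVT2'[of "\<lambda>\<theta>. Determinant.det (R \<theta>)" "pi / n" 0 0, OF _ _ _ c] shift by auto
  qed
  then obtain \<theta> where "Determinant.det (R \<theta>) = 0" by blast
  then have "Determinant.det (transpose_mat (R \<theta>)) = 0" using det_transpose[OF R] by simp
  then obtain v where v: "v \<in> carrier_vec (2 * n)" "v \<noteq> 0\<^sub>v (2 * n)" "transpose_mat (R \<theta>) *\<^sub>v v = 0\<^sub>v (2 * n)"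
    using det_0_iff_vec_prod_zero_field[of "transpose_mat (R \<theta>)" "2 * n"] R by auto
  define c where "c j = vec_index v j" for j
  have "\<exists>j<2 * n. c j \<noteq> 0"
  proof (rule ccontr)
    assume "\<not> ?thesis"
    then have "v = 0\<^sub>v (2 * n)" using v(1) by (intro eq_vecI) (auto simp: c_def)
    then show False using v by simp
  qed
  moreover have "(\<Sum>j<2 * n. c j * b i (node n \<theta> j)) = 0" if i: "i < 2 * n" for i
  proof -
    have "0 = vec_index (transpose_mat (R \<theta>) *\<^sub>v v) i" using v(3) i by simp
    also have "\<dots> = (\<Sum>j<2 * n. c j * b i (node n \<theta> j))"
      using i v(1) by (simp add: R_def scalar_prod_def c_def mult.commute lessThan_atLeast0)
    finally show ?thesis by simp
  qed
  ultimately show ?thesis by blast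
qed

section \<open>Lower bounds for the widths\<close>

text \<open>The largest \<open>\<epsilon>\<close> for which amplitudes up to \<open>sqrt 2 * \<epsilon>\<close> in degrees below \<open>n\<close> and up to \<open>\<epsilon>\<close> in
degree \<open>n\<close> guarantee membership in the class.\<close>

definition width_lower :: "(nat \<Rightarrow> real) \<Rightarrow> nat \<Rightarrow> real" where
  "width_lower \<psi> n = 1 / sqrt (pi * (1 / (\<psi> n)\<^sup>2 + 2 * (\<Sum>k\<in>{1..<n}. 1 / (\<psi> k)\<^sup>2)))"

lemma width_lower_pos:
  assumes "\<And>k. k \<ge> 1 \<Longrightarrow> 0 < \<psi> k" "n \<ge> 1"
  shows "0 < width_lower \<psi> n"
proof -
  have "0 < 1 / (\<psi> n)\<^sup>2" using assms(1)[OF assms(2)] by simp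
  moreover have "0 \<le> (\<Sum>k\<in>{1..<n}. 1 / (\<psi> k)\<^sup>2)" by (intro sum_nonneg) simp
  ultimately have "0 < pi * (1 / (\<psi> n)\<^sup>2 + 2 * (\<Sum>k\<in>{1..<n}. 1 / (\<psi> k)\<^sup>2))"
    by (intro mult_pos_pos pi_gt_zero) linarith
  then show ?thesis unfolding width_lower_def by simp
qed

lemma trig_polynomial_mem_C_conv_class:
  assumes pos: "\<And>k. k \<ge> 1 \<Longrightarrow> 0 < \<psi> k" and ker: "is_kernel \<psi> \<beta> \<Psi>" and n: "n \<ge> 1"
    and low: "\<And>k. k \<in> {1..<n} \<Longrightarrow> (c (2 * k - 1))\<^sup>2 + (c (2 * k))\<^sup>2 \<le> 2 * (width_lower \<psi> n)\<^sup>2"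
    and top: "(c (2 * n - 1))\<^sup>2 + (c (2 * n))\<^sup>2 \<le> (width_lower \<psi> n)\<^sup>2"
  shows "(\<Sum>i\<le>2 * n. c i *\<^sub>R trig_fun i) \<in> C_conv_class \<psi> \<beta>"
proof -
  define E where "E = (width_lower \<psi> n)\<^sup>2"
  define D where "D = 1 / (\<psi> n)\<^sup>2 + 2 * (\<Sum>k\<in>{1..<n}. 1 / (\<psi> k)\<^sup>2)"
  have "0 < 1 / (\<psi> n)\<^sup>2" using pos[OF n] by simp
  moreover have "0 \<le> (\<Sum>k\<in>{1..<n}. 1 / (\<psi> k)\<^sup>2)" by (intro sum_nonneg) simp
  ultimately have D: "0 < D" unfolding D_def by linarith
  have E: "E = 1 / (pi * D)"
    unfolding E_def width_lower_def D_def[symmetric] using D by (simp add: power_divide)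
  have bound: "(\<Sum>i\<in>{1..2 * n}. (c i / \<psi> (Suc i div 2))\<^sup>2) \<le> 1 / pi"
  proof -
    have "(\<Sum>i\<in>{1..2 * n}. (c i / \<psi> (Suc i div 2))\<^sup>2) =
        (\<Sum>k\<in>{1..n}. ((c (2 * k - 1))\<^sup>2 + (c (2 * k))\<^sup>2) / (\<psi> k)\<^sup>2)"
      unfolding sum_pairs by (intro sum.cong refl) (auto simp: power_divide add_divide_distrib)
    also have "{1..n} = insert n {1..<n}" using n by auto
    also have "(\<Sum>k\<in>insert n {1..<n}. ((c (2 * k - 1))\<^sup>2 + (c (2 * k))\<^sup>2) / (\<psi> k)\<^sup>2) =
       ((c (2 * n - 1))\<^sup>2 + (c (2 * n))\<^sup>2) / (\<psi> n)\<^sup>2 + (\<Sum>k\<in>{1..<n}. ((c (2 * k - 1))\<^sup>2 + (c (2 * k))\<^sup>2) / (\<psi> k)\<^sup>2)"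
      by (subst sum.insert) auto
    also have "\<dots> \<le> E / (\<psi> n)\<^sup>2 + (\<Sum>k\<in>{1..<n}. 2 * E / (\<psi> k)\<^sup>2)"
      unfolding E_def using low top by (intro add_mono sum_mono divide_right_mono) auto
    also have "\<dots> = E * D"
      by (simp add: D_def distrib_left sum_distrib_left sum_divide_distrib) (simp add: mult_ac)
    also have "\<dots> = 1 / pi" using D by (simp add: E)
    finally show ?thesis .
  qed
  have "apply_bcontfun (\<Sum>i\<le>2 * n. c i *\<^sub>R trig_fun i) \<in> conv_class \<psi> \<beta>"
    by (rule trig_polynomial_mem_conv_class[OF pos ker _ bound]) (simp_all add: apply_bcontfun_sum)
  moreover have "(\<Sum>i\<le>2 * n. c i *\<^sub>R trig_fun i) \<in> C_periodic"
    by (intro subspace_sum[OF subspace_C_periodic] subspace_scale[OF subspace_C_periodic])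
       (simp add: C_periodic_def periodic_trig)
  ultimately show ?thesis by (simp add: C_conv_class_def)
qed

lemma bernstein_width_ge:
  assumes pos: "\<And>k. k \<ge> 1 \<Longrightarrow> 0 < \<psi> k" and ker: "is_kernel \<psi> \<beta> \<Psi>" and n: "n \<ge> 1" and N: "N \<le> 2 * n"
  shows "ennreal (width_lower \<psi> n) \<le> bernstein_width N (C_conv_class \<psi> \<beta>)"
  unfolding bernstein_width_def
proof (rule SUP_upper2[OF span_trig_fun_C_subspaces], rule SUP_upper2)
  show "width_lower \<psi> n \<in> {\<epsilon>. 0 < \<epsilon> \<and> cball 0 \<epsilon> \<inter> span (trig_fun ` {..<N + 1}) \<subseteq> C_conv_class \<psi> \<beta>}"
  proof (intro CollectI conjI subsetI)
    show "0 < width_lower \<psi> n" by (rule width_lower_pos[OF pos n])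
    fix f assume "f \<in> cball 0 (width_lower \<psi> n) \<inter> span (trig_fun ` {..<N + 1})"
    then have f: "norm f \<le> width_lower \<psi> n" "f \<in> span (trig_fun ` {..<N + 1})" by auto
    define c where "c i = (if i < N + 1 then trig_coeff i f else 0)" for i
    have "f = (\<Sum>i<N + 1. trig_coeff i f *\<^sub>R trig_fun i)" using f(2) by (intro span_trig_fun_expand) auto
    also have "\<dots> = (\<Sum>i\<le>2 * n. c i *\<^sub>R trig_fun i)"
      using N by (intro sum.mono_neutral_cong_left) (auto simp: c_def)
    finally have fc: "f = (\<Sum>i\<le>2 * n. c i *\<^sub>R trig_fun i)" .
    have "\<bar>\<Sum>i\<le>2 * n. c i * trig i x\<bar> \<le> width_lower \<psi> n" for x
    proof -
      have "apply_bcontfun f x = (\<Sum>i\<le>2 * n. c i * trig i x)" by (subst fc) (simp add: apply_bcontfun_sum)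
      then show ?thesis using norm_bounded[of f x] f(1) by simp
    qed
    note b = trig_polynomial_coeff_bounds[OF n this]
    show "f \<in> C_conv_class \<psi> \<beta>"
      unfolding fc by (rule trig_polynomial_mem_C_conv_class[OF pos ker n b])
  qed
qed simp

text \<open>Let \<open>\<Sum>j. c j * u (x j)\<close> annihilate \<open>F\<close>, and let \<open>f\<close> interpolate \<open>L * sgn (c j)\<close>. Applied to \<open>f - u\<close> with
\<open>u \<in> F\<close>, the functional has the value \<open>L * (\<Sum>j. \<bar>c j\<bar>)\<close>, while its norm is at most \<open>\<Sum>j. \<bar>c j\<bar>\<close>.\<close>

lemma kolmogorov_width_ge:
  assumes pos: "\<And>k. k \<ge> 1 \<Longrightarrow> 0 < \<psi> k" and ker: "is_kernel \<psi> \<beta> \<Psi>" and n: "n \<ge> 1" and N: "N \<le> 2 * n"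
  shows "ennreal (width_lower \<psi> n) \<le> kolmogorov_width N (C_conv_class \<psi> \<beta>)"
  unfolding kolmogorov_width_def
proof (rule INF_greatest)
  fix F assume "F \<in> C_subspaces N"
  then obtain B where B: "finite B" "card B = N" "span B = F" and FC: "F \<subseteq> C_periodic"
    by (auto simp: C_subspaces_def)
  obtain h where h: "bij_betw h {0..<N} B" using ex_bij_betw_nat_finite[OF B(1)] B(2) by auto
  \<comment> \<open>The basis of \<open>F\<close>, completed by zeros to \<open>2 * n\<close> functions.\<close>
  define b where "b i = (if i < N then apply_bcontfun (h i) else (\<lambda>_. 0))" for i
  have hB: "h i \<in> B" if "i < N" for i using h that by (auto simp: bij_betw_def)
  have BC: "B \<subseteq> C_periodic" using FC B(3) span_superset by blast
  have "continuous_on UNIV (b i)" for i by (auto simp: b_def)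
  moreover have "periodic_2pi (b i)" for i
    using hB BC by (auto simp: b_def C_periodic_def periodic_2pi_def subset_eq)
  ultimately obtain \<theta> c where c: "\<exists>j<2 * n. c j \<noteq> 0"
    and ann: "\<forall>i<2 * n. (\<Sum>j<2 * n. c j * b i (node n \<theta> j)) = 0"
    using exists_node_annihilator[OF n, of b] by blast
  define x where "x = node n \<theta>"
  have annF: "(\<Sum>j<2 * n. c j * apply_bcontfun u (x j)) = 0" if "u \<in> F" for u
  proof -
    have "u \<in> span B" using that B by simp
    then show ?thesis
    proof (induction rule: span_induct_alt)
      case (step a w y)
      obtain i where i: "i < N" "w = h i" using h step.hyps(1) by (auto simp: bij_betw_def)
      have "(\<Sum>j<2 * n. c j * apply_bcontfun w (x j)) = 0"
        using ann[rule_format, of i] i N by (simp add: b_def x_def)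
      moreover have "(\<Sum>j<2 * n. c j * apply_bcontfun (a *\<^sub>R w + y) (x j)) =
        a * (\<Sum>j<2 * n. c j * apply_bcontfun w (x j)) + (\<Sum>j<2 * n. c j * apply_bcontfun y (x j))"
        by (simp add: distrib_left sum.distrib sum_distrib_left mult_ac)
      ultimately show ?case using step.IH by simp
    qed simp
  qed
  define L where "L = width_lower \<psi> n"
  have L: "0 < L" unfolding L_def by (rule width_lower_pos[OF pos n])
  have sgn_le: "\<bar>L * sgn (c j)\<bar> \<le> L" if "j < 2 * n" for j using L by (simp add: abs_mult sgn_if)
  obtain d where d: "\<forall>j<2 * n. (\<Sum>i\<le>2 * n. d i * trig i (node n \<theta> j)) = L * sgn (c j)"
    and low: "\<forall>k\<in>{1..<n}. (d (2 * k - 1))\<^sup>2 + (d (2 * k))\<^sup>2 \<le> 2 * L\<^sup>2"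
    and top: "(d (2 * n - 1))\<^sup>2 + (d (2 * n))\<^sup>2 \<le> L\<^sup>2"
    using trig_interpolation[OF n, of "\<lambda>j. L * sgn (c j)" L \<theta>, OF sgn_le] by blast
  define f where "f = (\<Sum>i\<le>2 * n. d i *\<^sub>R trig_fun i)"
  have fK: "f \<in> C_conv_class \<psi> \<beta>"
    unfolding f_def using low top by (intro trig_polynomial_mem_C_conv_class[OF pos ker n]) (auto simp: L_def)
  have fx: "apply_bcontfun f (x j) = L * sgn (c j)" if "j < 2 * n" for j
    using d that by (simp add: f_def apply_bcontfun_sum x_def)
  have C: "0 < (\<Sum>j<2 * n. \<bar>c j\<bar>)"
    using c by (auto intro!: sum_pos2)
  have "L \<le> norm (f - u)" if u: "u \<in> F" for u
  proof -
    have "L * (\<Sum>j<2 * n. \<bar>c j\<bar>) = (\<Sum>j<2 * n. c j * apply_bcontfun f (x j))"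
      unfolding sum_distrib_left by (intro sum.cong refl) (simp add: fx abs_sgn mult_ac)
    also have "\<dots> = (\<Sum>j<2 * n. c j * apply_bcontfun (f - u) (x j))"
      using annF[OF u] by (simp add: right_diff_distrib sum_subtractf)
    also have "\<dots> \<le> (\<Sum>j<2 * n. \<bar>c j\<bar> * norm (f - u))"
    proof (rule sum_mono)
      fix j
      have "c j * apply_bcontfun (f - u) (x j) \<le> \<bar>c j\<bar> * \<bar>apply_bcontfun (f - u) (x j)\<bar>"
        by (metis abs_ge_self abs_mult)
      also have "\<dots> \<le> \<bar>c j\<bar> * norm (f - u)"
        using norm_bounded[of "f - u" "x j"] by (intro mult_left_mono) auto
      finally show "c j * apply_bcontfun (f - u) (x j) \<le> \<bar>c j\<bar> * norm (f - u)" .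
    qed
    finally show ?thesis using C by (simp add: sum_distrib_right[symmetric] mult.commute)
  qed
  then have "ennreal L \<le> (INF u\<in>F. ennreal (norm (f - u)))"
    by (intro INF_greatest ennreal_leI)
  then show "ennreal (width_lower \<psi> n) \<le> (SUP f\<in>C_conv_class \<psi> \<beta>. INF u\<in>F. ennreal (norm (f - u)))"
    unfolding L_def by (rule SUP_upper2[OF fK])
qed

section \<open>The asymptotic formula\<close>

lemma summable_of_ratio_tendsto_0:
  fixes \<psi> :: "nat \<Rightarrow> real"
  assumes pos: "\<And>k. k \<ge> 1 \<Longrightarrow> 0 < \<psi> k" and lim: "(\<lambda>k. \<psi> (k + 1) / \<psi> k) \<longlonglongrightarrow> 0"
  shows "summable (\<lambda>k. \<psi> (Suc k))"
proof -
  have "\<forall>\<^sub>F k in sequentially. \<psi> (k + 1) / \<psi> k < 1 / 2"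
    using order_tendstoD(2)[OF lim, of "1 / 2"] by simp
  then obtain K where K: "\<And>k. k \<ge> K \<Longrightarrow> \<psi> (k + 1) / \<psi> k < 1 / 2"
    by (auto simp: eventually_sequentially)
  show ?thesis
  proof (rule summable_ratio_test[where c = "1 / 2" and N = K])
    fix k assume "K \<le> k"
    then have "\<psi> (Suc k + 1) / \<psi> (Suc k) < 1 / 2" by (intro K) simp
    then show "norm (\<psi> (Suc (Suc k))) \<le> 1 / 2 * norm (\<psi> (Suc k))"
      using pos[of "Suc k"] pos[of "Suc (Suc k)"] by (simp add: field_simps)
  qed simp
qed

text \<open>With \<open>z = sqrt 2 * \<psi> n * S\<close> the claim reduces to \<open>1 / sqrt (1 + z\<^sup>2) \<ge> 1 - z\<close> and \<open>sqrt 2 \<le> sqrt pi\<close>.\<close>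

lemma width_lower_ge:
  assumes pos: "0 < \<psi> n"
  shows "\<psi> n * (1 / sqrt pi - \<psi> n * sqrt (\<Sum>k\<in>{1..<n}. 1 / (\<psi> k)\<^sup>2)) \<le> width_lower \<psi> n"
proof -
  define S where "S = sqrt (\<Sum>k\<in>{1..<n}. 1 / (\<psi> k)\<^sup>2)"
  define z where "z = sqrt 2 * (\<psi> n * S)"
  have S0: "0 \<le> (\<Sum>k\<in>{1..<n}. 1 / (\<psi> k)\<^sup>2)" by (intro sum_nonneg) simp
  have S2: "S\<^sup>2 = (\<Sum>k\<in>{1..<n}. 1 / (\<psi> k)\<^sup>2)" and S: "0 \<le> S" using S0 by (auto simp: S_def)
  have z: "0 \<le> z" "z\<^sup>2 = 2 * ((\<psi> n)\<^sup>2 * S\<^sup>2)"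
    using S pos by (auto simp: z_def power_mult_distrib)
  have "pi * (1 / (\<psi> n)\<^sup>2 + 2 * S\<^sup>2) = pi * (1 + z\<^sup>2) / (\<psi> n)\<^sup>2"
    using pos by (simp add: z field_simps)
  then have low: "width_lower \<psi> n = \<psi> n / (sqrt pi * sqrt (1 + z\<^sup>2))"
    unfolding width_lower_def S2[symmetric] using pos by (simp add: real_sqrt_mult real_sqrt_divide)
  have "1 + z\<^sup>2 \<le> (1 + z)\<^sup>2" using z by (simp add: power2_sum)
  then have "sqrt (1 + z\<^sup>2) \<le> 1 + z" using z by (intro real_le_lsqrt) auto
  have "(1 - z) * sqrt (1 + z\<^sup>2) \<le> 1"
  proof (cases "z \<le> 1")
    case True
    then have "(1 - z) * sqrt (1 + z\<^sup>2) \<le> (1 - z) * (1 + z)"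
      using \<open>sqrt (1 + z\<^sup>2) \<le> 1 + z\<close> by (intro mult_left_mono) auto
    also have "\<dots> \<le> 1" by (simp add: algebra_simps power2_eq_square[symmetric])
    finally show ?thesis .
  next
    case False
    then have "(1 - z) * sqrt (1 + z\<^sup>2) \<le> 0" by (intro mult_nonpos_nonneg) auto
    then show ?thesis by simp
  qed
  moreover have "0 < sqrt (1 + z\<^sup>2)" by (simp add: add_pos_nonneg)
  ultimately have "1 - z \<le> 1 / sqrt (1 + z\<^sup>2)" by (simp add: field_simps)
  then have "\<psi> n / sqrt pi * (1 - z) \<le> \<psi> n / sqrt pi * (1 / sqrt (1 + z\<^sup>2))"
    using pos by (intro mult_left_mono) auto
  also have "\<dots> = width_lower \<psi> n" by (simp add: low)
  finally have "\<psi> n / sqrt pi * (1 - z) \<le> width_lower \<psi> n" .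
  moreover have "\<psi> n * (1 / sqrt pi - \<psi> n * S) \<le> \<psi> n / sqrt pi * (1 - z)"
  proof -
    have "sqrt 2 \<le> sqrt pi" using pi_gt3 by simp
    then have "sqrt 2 / sqrt pi \<le> 1" by simp
    then have "(sqrt 2 / sqrt pi) * (\<psi> n * S) \<le> 1 * (\<psi> n * S)" using pos S by (intro mult_right_mono) auto
    then have "1 / sqrt pi - \<psi> n * S \<le> 1 / sqrt pi * (1 - z)" by (simp add: z_def algebra_simps)
    then have "\<psi> n * (1 / sqrt pi - \<psi> n * S) \<le> \<psi> n * (1 / sqrt pi * (1 - z))" using pos by (intro mult_left_mono) auto
    then show ?thesis by simp
  qed
  ultimately show ?thesis unfolding S_def by linarith
qed

lemma width_upper_le:
  assumes pos: "0 < \<psi> n" and s: "summable (\<lambda>k. (\<psi> (n + k))\<^sup>2)"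
  shows "sqrt ((\<Sum>k. (\<psi> (n + k))\<^sup>2) / pi) \<le> \<psi> n * (1 / sqrt pi + 1 / \<psi> n * sqrt (\<Sum>k. (\<psi> (n + 1 + k))\<^sup>2))"
proof -
  define T where "T = (\<Sum>k. (\<psi> (n + 1 + k))\<^sup>2)"
  have "summable (\<lambda>k. (\<psi> (n + 1 + k))\<^sup>2)"
    using s summable_Suc_iff[of "\<lambda>k. (\<psi> (n + k))\<^sup>2"] by simp
  then have T: "0 \<le> T" unfolding T_def by (intro suminf_nonneg) auto
  have "(\<Sum>k. (\<psi> (n + k))\<^sup>2) = (\<psi> n)\<^sup>2 + T"
    using suminf_split_head[OF s] by (simp add: T_def)
  then have "sqrt ((\<Sum>k. (\<psi> (n + k))\<^sup>2) / pi) = sqrt ((\<psi> n)\<^sup>2 + T) / sqrt pi"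
    by (simp add: real_sqrt_divide)
  also have "\<dots> \<le> (\<psi> n + sqrt T) / sqrt pi"
    using sqrt_add_le_add_sqrt[of "(\<psi> n)\<^sup>2" T] T pos by (intro divide_right_mono) auto
  also have "\<dots> \<le> \<psi> n / sqrt pi + sqrt T"
  proof -
    have "1 \<le> sqrt pi" using pi_gt3 by simp
    then have "sqrt T * 1 \<le> sqrt T * sqrt pi" using T by (intro mult_left_mono) auto
    then have "sqrt T / sqrt pi \<le> sqrt T" by (simp add: divide_le_eq)
    then show ?thesis by (simp add: add_divide_distrib)
  qed
  also have "\<dots> = \<psi> n * (1 / sqrt pi + 1 / \<psi> n * sqrt T)" using pos by (simp add: field_simps)
  finally show ?thesis unfolding T_def .
qed

theorem corollary1p1:
  "\<exists>M::real. \<forall>(\<psi>::nat \<Rightarrow> real) (\<beta>::nat \<Rightarrow> real).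
     (\<forall>k\<ge>1. 0 < \<psi> k) \<longrightarrow> strict_antimono_on {1..} \<psi> \<longrightarrow>
     (\<lambda>k. \<psi> (k + 1) / \<psi> k) \<longlonglongrightarrow> 0 \<longrightarrow>
     (\<forall>P\<in>{bernstein_width, kolmogorov_width, linear_width, projection_width}.
      \<forall>n\<ge>1. \<forall>N\<in>{2 * n, 2 * n - 1}.
        \<exists>r::real. \<bar>r\<bar> \<le> M \<and>
          enn2ereal (P N (C_conv_class \<psi> \<beta>)) =
          ereal (\<psi> n * (1 / sqrt pi + r *
            max (\<psi> n * sqrt (\<Sum>k=1..n-1. 1 / (\<psi> k)\<^sup>2))
                (1 / \<psi> n * sqrt (\<Sum>k. (\<psi> (n + 1 + k))\<^sup>2)))))"
proof (rule exI[of _ 1], intro allI impI ballI)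
  fix \<psi> \<beta> :: "nat \<Rightarrow> real" and P :: "nat \<Rightarrow> (real \<Rightarrow>\<^sub>C real) set \<Rightarrow> ennreal" and n N :: nat
  assume psi: "\<forall>k\<ge>1. 0 < \<psi> k" and lim: "(\<lambda>k. \<psi> (k + 1) / \<psi> k) \<longlonglongrightarrow> 0"
    and P: "P \<in> {bernstein_width, kolmogorov_width, linear_width, projection_width}"
    and n: "1 \<le> n" and "N \<in> {2 * n, 2 * n - 1}"
  then have N: "N \<le> 2 * n" "2 * n - 1 \<le> N" by auto
  have pos: "0 < \<psi> k" if "k \<ge> 1" for k using psi that by blast
  have sum: "summable (\<lambda>k. \<psi> (Suc k))" by (rule summable_of_ratio_tendsto_0[OF pos lim])
  have sq: "summable (\<lambda>k. (\<psi> (m + k))\<^sup>2)" if "m \<ge> 1" for m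
    using summable_square[OF pos sum, of "m - 1"] that by simp
  note ker = is_kernel_kernel_series[OF pos sum, of \<beta>]
  let ?K = "C_conv_class \<psi> \<beta>"
  define S where "S = \<psi> n * sqrt (\<Sum>k=1..n-1. 1 / (\<psi> k)\<^sup>2)"
  define T where "T = 1 / \<psi> n * sqrt (\<Sum>k. (\<psi> (n + 1 + k))\<^sup>2)"
  define L where "L = width_lower \<psi> n"
  define U where "U = sqrt ((\<Sum>k. (\<psi> (n + k))\<^sup>2) / pi)"
  have rem: "norm (f - fourier_projection N f) \<le> U" if "f \<in> ?K" for f
    unfolding U_def by (rule norm_fourier_remainder_le[OF pos sum that n N(2)])
  have KC: "?K \<subseteq> C_periodic" by (auto simp: C_conv_class_def)
  note order = kolmogorov_le_linear_width[OF KC, of N] linear_le_projection_width[of N ?K]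
  have "ennreal L \<le> P N ?K"
    using P bernstein_width_ge[OF pos ker n N(1)] kolmogorov_width_ge[OF pos ker n N(1)] order
    unfolding L_def by (auto intro: order_trans)
  moreover have "P N ?K \<le> ennreal U"
    using P bernstein_width_le[OF rem] projection_width_le[OF rem] order
    by (auto intro: order_trans)
  moreover have L0: "0 < L" unfolding L_def by (rule width_lower_pos[OF pos n])
  ultimately obtain p where p: "P N ?K = ennreal p" "L \<le> p" "p \<le> U"
  proof -
    assume LU: "ennreal L \<le> P N ?K" "P N ?K \<le> ennreal U" "0 < L"
    have "P N ?K < Orderings.top" using LU(2) ennreal_less_top[of U] by (rule le_less_trans)
    then obtain q where q: "0 \<le> q" "P N ?K = ennreal q" by (cases "P N ?K") auto
    have U0: "0 \<le> U" unfolding U_def using suminf_nonneg[OF sq[OF n]] by simp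
    show ?thesis using that[OF q(2)] LU q U0 by (simp add: ennreal_le_iff)
  qed
  have "{1..n - 1} = {1..<n}" using n by auto
  then have Lge: "\<psi> n * (1 / sqrt pi - S) \<le> L"
    using width_lower_ge[of \<psi> n, OF pos[OF n]] by (simp add: S_def L_def)
  have Ule: "U \<le> \<psi> n * (1 / sqrt pi + T)"
    unfolding U_def T_def by (rule width_upper_le[of \<psi> n, OF pos[OF n] sq[OF n]])
  have T: "0 < T"
  proof -
    have "0 < (\<Sum>k. (\<psi> (n + 1 + k))\<^sup>2)"
      using sq[of "n + 1"] by (intro suminf_pos zero_less_power pos) auto
    then show ?thesis using pos[OF n] by (simp add: T_def)
  qed
  define m where "m = max S T"
  define r where "r = (p / \<psi> n - 1 / sqrt pi) / m"
  have m: "0 < m" "S \<le> m" "T \<le> m" using T by (auto simp: m_def)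
  have "1 / sqrt pi - S \<le> p / \<psi> n" "p / \<psi> n \<le> 1 / sqrt pi + T"
    using p Lge Ule pos[OF n] by (simp_all add: pos_le_divide_eq pos_divide_le_eq mult.commute)
  then have "\<bar>p / \<psi> n - 1 / sqrt pi\<bar> \<le> m" using m by linarith
  then have "\<bar>r\<bar> \<le> 1" using m by (simp add: r_def)
  moreover have "p = \<psi> n * (1 / sqrt pi + r * m)"
    using m pos[OF n] by (simp add: r_def)
  moreover have "0 \<le> p" using p(2) L0 by linarith
  ultimately show "\<exists>r. \<bar>r\<bar> \<le> 1 \<and> enn2ereal (P N ?K) =
      ereal (\<psi> n * (1 / sqrt pi + r * max (\<psi> n * sqrt (\<Sum>k=1..n-1. 1 / (\<psi> k)\<^sup>2))
                (1 / \<psi> n * sqrt (\<Sum>k. (\<psi> (n + 1 + k))\<^sup>2))))"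
    unfolding S_def[symmetric] T_def[symmetric] m_def[symmetric] p(1)
    by (intro exI[of _ r]) (simp add: enn2ereal_ennreal)
qed

end
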